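(* Let $V$ be a countable set with a left action of a group $\Gamma$ having finitely many orbits, and let $\mu$ be a measure on the set of orbits such that the Mass-Transport Principle holds for the action with respect to $\mu$. Let $\alpha$ assign to each subset $U\subseteq V$ a number $\alpha_U\in[0,\infty)$ such that: (i) $\alpha_U=\alpha_{\gamma U}$ for all $U\subset V$ and $\gamma\in\Gamma$; (ii) $\alpha_U=0$ if $U$ is not finite; (iii) for any $v\in V$ there are only finitely many $U$ with $v\in U$ and $\alpha_U\neq 0$. Let $Z_u$, $u\in V$, be an IID process on $V$. Suppose that $X_v$, $v\in V$, is a $\Gamma$-factor of $Z$ with finite state space such that for any $u\in V$ the value of $Z_u$ influences only the labels $X_v$, $v\in W_u$, for some finite set $W_u\subset V$. Then $$\mathbb{E}_{\mu(o)}\sum_{U:\ o\in U}\frac{\alpha_U}{|U|}H(X_U)\ \ge\ \beta\,\mathbb{E}_{\mu(o)}H(X_o),\qquad\text{where}\quad \beta=\min_{u\in V;\ W\subseteq W_u}\frac{\sum_{U\subseteq V;\ U\cap W\neq\emptyset}\alpha_U}{|W|}.$$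
   Context: $\mu$ is a probability measure on the (finite) set of $\Gamma$-orbits of $V$; for a function $g$ on $V$ that is constant on orbits, $\mathbb{E}_{\mu(o)}g(o)$ denotes the sum over orbits of $\mu(\text{orbit})$ times the value of $g$ at any representative $o$ of the orbit. A function $f:V\times V\to[0,\infty]$ is diagonally $\Gamma$-invariant if $f(\gamma u,\gamma v)=f(u,v)$ for all $u,v\in V$, $\gamma\in\Gamma$. The Mass-Transport Principle holds for the action with respect to $\mu$ if for every diagonally $\Gamma$-invariant $f$, $$\mathbb{E}_{\mu(o)}\sum_{v\in V}f(o,v)=\mathbb{E}_{\mu(o)}\sum_{v\in V}f(v,o).$$ An IID process $Z=(Z_u)_{u\in V}$ consists of independent uniform $[0,1]$ random variables. A $\Gamma$-factor of $Z$ with state space $M$ is $X=F(Z)$ with $F:[0,1]^V\to M^V$ measurable and $\Gamma$-equivariant. The influence condition means that each $X_v$ is a measurable function of those $Z_u$ for which $v\in W_u$. For finite $U\subset V$, $H(X_U)$ is the Shannon entropy ($\sum_j -p_j\log p_j$) of the joint distribution of $X_U=(X_v)_{v\in U}$. The minimum (understood as an infimum) is over all $u\in V$ and nonempty $W\subseteq W_u$; at least one $W_u$ is nonempty. Terms with $\alpha_U=0$ are omitted from the sums. *)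

theory Defs
  imports "HOL-Probability.Probability" "HOL-Algebra.Group_Action"
begin

text \<open>
  A probability measure \<open>\<mu>\<close> on the set of orbits is a \<open>pmf\<close> supported in \<open>orbits G V \<phi>\<close>.
  The expectation of \<open>g\<close> evaluates \<open>g\<close> at an arbitrary representative of each orbit; it is only
  meaningful when \<open>g\<close> is constant on orbits. The second version takes values in \<open>[0,\<infinity>]\<close>.
\<close>

definition orbit_expectation :: "'v set pmf \<Rightarrow> ('v \<Rightarrow> real) \<Rightarrow> real" where
  "orbit_expectation \<mu> g = (\<Sum>C\<in>set_pmf \<mu>. pmf \<mu> C * g (SOME v. v \<in> C))"

definition orbit_nn_expectation :: "'v set pmf \<Rightarrow> ('v \<Rightarrow> ennreal) \<Rightarrow> ennreal" where
  "orbit_nn_expectation \<mu> g = (\<Sum>C\<in>set_pmf \<mu>. ennreal (pmf \<mu> C) * g (SOME v. v \<in> C))"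

definition diagonally_invariant ::
    "('g, 'r) monoid_scheme \<Rightarrow> 'v set \<Rightarrow> ('g \<Rightarrow> 'v \<Rightarrow> 'v) \<Rightarrow> ('v \<Rightarrow> 'v \<Rightarrow> ennreal) \<Rightarrow> bool" where
  "diagonally_invariant G V \<phi> f \<longleftrightarrow>
     (\<forall>\<gamma>\<in>carrier G. \<forall>u\<in>V. \<forall>v\<in>V. f (\<phi> \<gamma> u) (\<phi> \<gamma> v) = f u v)"

definition mass_transport_principle ::
    "('g, 'r) monoid_scheme \<Rightarrow> 'v set \<Rightarrow> ('g \<Rightarrow> 'v \<Rightarrow> 'v) \<Rightarrow> 'v set pmf \<Rightarrow> bool" where
  "mass_transport_principle G V \<phi> \<mu> \<longleftrightarrow>
     (\<forall>f. diagonally_invariant G V \<phi> f \<longrightarrow>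
        orbit_nn_expectation \<mu> (\<lambda>o'. \<integral>\<^sup>+ v. f o' v \<partial>count_space V) =
        orbit_nn_expectation \<mu> (\<lambda>o'. \<integral>\<^sup>+ v. f v o' \<partial>count_space V))"

definition unit_lborel :: "real measure" where
  "unit_lborel = restrict_space lborel {0..1}"

definition iid_process :: "'w measure \<Rightarrow> 'v set \<Rightarrow> ('v \<Rightarrow> 'w \<Rightarrow> real) \<Rightarrow> bool" where
  "iid_process M V Z \<longleftrightarrow> prob_space M \<and>
     prob_space.indep_vars M (\<lambda>_. unit_lborel) Z V \<and>
     (\<forall>u\<in>V. distr M unit_lborel (Z u) = unit_lborel)"

text \<open>The induced left action on labellings: \<open>(\<gamma> z) v = z (\<gamma>\<^sup>-\<^sup>1 v)\<close>.\<close>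

definition act_labelling ::
    "('g, 'r) monoid_scheme \<Rightarrow> 'v set \<Rightarrow> ('g \<Rightarrow> 'v \<Rightarrow> 'v) \<Rightarrow> 'g \<Rightarrow> ('v \<Rightarrow> 'a) \<Rightarrow> ('v \<Rightarrow> 'a)" where
  "act_labelling G V \<phi> \<gamma> z = (\<lambda>v\<in>V. z (\<phi> (inv\<^bsub>G\<^esub> \<gamma>) v))"

text \<open>Here \<open>S\<close> is the (discrete) state space of the factor.\<close>

definition is_factor ::
    "('g, 'r) monoid_scheme \<Rightarrow> 'v set \<Rightarrow> ('g \<Rightarrow> 'v \<Rightarrow> 'v) \<Rightarrow> 's set \<Rightarrow> 'w measure \<Rightarrow>
     ('v \<Rightarrow> 'w \<Rightarrow> real) \<Rightarrow> ('v \<Rightarrow> 'w \<Rightarrow> 's) \<Rightarrow> bool" where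
  "is_factor G V \<phi> S M Z X \<longleftrightarrow>
     (\<exists>F \<in> PiM V (\<lambda>_. unit_lborel) \<rightarrow>\<^sub>M PiM V (\<lambda>_. count_space S).
        (\<forall>\<gamma>\<in>carrier G. \<forall>z\<in>space (PiM V (\<lambda>_. unit_lborel)).
           F (act_labelling G V \<phi> \<gamma> z) = act_labelling G V \<phi> \<gamma> (F z)) \<and>
        (\<forall>\<omega>\<in>space M. \<forall>v\<in>V. X v \<omega> = F (\<lambda>u\<in>V. Z u \<omega>) v))"

text \<open>\<open>Z u\<close> influences only the labels \<open>X v\<close> with \<open>v \<in> W u\<close>. As usual for random variables,
  being a function of part of the process is understood almost surely.\<close>

definition influence_within ::
    "'v set \<Rightarrow> 's set \<Rightarrow> 'w measure \<Rightarrow> ('v \<Rightarrow> 'w \<Rightarrow> real) \<Rightarrow> ('v \<Rightarrow> 'w \<Rightarrow> 's) \<Rightarrow>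
     ('v \<Rightarrow> 'v set) \<Rightarrow> bool" where
  "influence_within V S M Z X W \<longleftrightarrow>
     (\<forall>v\<in>V. \<exists>h \<in> PiM {u\<in>V. v \<in> W u} (\<lambda>_. unit_lborel) \<rightarrow>\<^sub>M count_space S.
        AE \<omega> in M. X v \<omega> = h (\<lambda>u\<in>{u\<in>V. v \<in> W u}. Z u \<omega>))"

text \<open>Shannon entropy, in nats, of a random variable taking finitely many values.\<close>

definition shannon_entropy :: "'w measure \<Rightarrow> ('w \<Rightarrow> 'a) \<Rightarrow> real" where
  "shannon_entropy M Y = prob_space.entropy M (exp 1) (count_space (Y ` space M)) Y"

definition joint_label :: "('v \<Rightarrow> 'w \<Rightarrow> 's) \<Rightarrow> 'v set \<Rightarrow> 'w \<Rightarrow> ('v \<Rightarrow> 's)" where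
  "joint_label X U \<omega> = (\<lambda>v\<in>U. X v \<omega>)"

text \<open>The minimum is an infimum, as \<open>u\<close> ranges over a possibly infinite set.\<close>

definition expansion_constant ::
    "'v set \<Rightarrow> ('v set \<Rightarrow> real) \<Rightarrow> ('v \<Rightarrow> 'v set) \<Rightarrow> real" where
  "expansion_constant V \<alpha> W =
     Inf {(\<Sum>U | U \<subseteq> V \<and> U \<inter> A \<noteq> {} \<and> \<alpha> U \<noteq> 0. \<alpha> U) / real (card A) | u A.
            u \<in> V \<and> A \<subseteq> W u \<and> A \<noteq> {}}"

end

theory Submission
  imports Defs
begin

text \<open>
  The entropy of the labels on a finite set \<open>U\<close> is generated by the variables \<open>Z\<^sub>u\<close>, and each of them can
  be charged with its part. Reveal the \<open>Z\<^sub>u\<close> one after the other. Revealing \<open>Z\<^sub>u\<close> when the \<open>Z\<^sub>a\<close>,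
  \<open>a \<in> A\<close>, are already known lowers the conditional entropy of \<open>X\<^sub>U\<close> by \<open>I(X\<^sub>U ; Z\<^sub>u | Z\<^sub>A)\<close>, and these
  decrements add up to \<open>H(X\<^sub>U)\<close>. The order of the revelation is not invariant under the group, so the
  decrement is averaged over all orders. The average \<open>J(U, u)\<close> is the Shapley value of \<open>u\<close> in the game
  \<open>A \<mapsto> I(X\<^sub>U ; Z\<^sub>A)\<close>. It has the following properties.

  \<^item> \<open>J(U, u)\<close> increases with \<open>U\<close>, because information about \<open>X\<^sub>U\<close> includes information about each
    \<open>X\<^sub>v\<close> with \<open>v \<in> U\<close>;
  \<^item> \<open>\<Sum>\<^sub>u J(U, u) \<le> H(X\<^sub>U)\<close> (\<open>sum_full_share_le\<close>) and \<open>\<Sum>\<^sub>u J({v}, u) \<ge> H(X\<^sub>v)\<close>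
    (\<open>sum_full_share_singleton_ge\<close>);
  \<^item> \<open>J({v}, u) = 0\<close> unless \<open>v \<in> W\<^sub>u\<close> (\<open>full_share_zero\<close>);
  \<^item> \<open>J\<close> is invariant under the diagonal action (\<open>full_share_relabel_le\<close>).

  Let \<open>o\<close> send to \<open>u\<close> the mass \<open>f(o, u) = \<Sum>\<^sub>U\<^sub>\<ni>\<^sub>o \<alpha>\<^sub>U/|U| J(U, u)\<close>. What \<open>o\<close> sends out is at most its
  term on the larger side of the theorem, and what \<open>u\<close> receives is \<open>\<Sum>\<^sub>U \<alpha>\<^sub>U J(U, u)\<close>, since each \<open>U\<close> is
  counted by its \<open>|U|\<close> elements. For fixed \<open>u\<close>, monotonicity bounds \<open>J(U, u)\<close> below by the maximum of
  \<open>J({v}, u)\<close> over \<open>v \<in> U \<inter> W\<^sub>u\<close>. Cutting the function \<open>v \<mapsto> J({v}, u)\<close> on \<open>W\<^sub>u\<close> into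
  its superlevel sets and applying the definition of \<open>\<beta>\<close> to each of them gives
  \<open>\<Sum>\<^sub>U \<alpha>\<^sub>U J(U, u) \<ge> \<beta> \<Sum>\<^sub>v J({v}, u)\<close> (\<open>threshold_domination\<close>). Transporting the mass \<open>J({v}, u)\<close>
  from \<open>u\<close> back to \<open>v\<close> turns the expectation of the last sum into at least that of \<open>H(X\<^sub>o)\<close>.

  Two approximations reduce all information quantities to entropies of finite-valued variables. The
  real number \<open>Z\<^sub>u\<close> is replaced by the bits that compare it with the first \<open>k\<close> rational numbers, and only the
  vertices of a finite set \<open>N\<close> take part in the game. Since \<open>Z\<^sub>u\<close> is independent of the other
  variables, \<open>I(X\<^sub>U ; Z\<^sub>u | Z\<^sub>A) = I(Z\<^sub>u ; X\<^sub>U, Z\<^sub>A)\<close>. The right-hand side increases with \<open>U\<close>, \<open>A\<close> and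
  \<open>k\<close>, so the finite Shapley values increase to a limit along any exhaustion of \<open>V\<close>, and that limit
  does not depend on the exhaustion. In the limit nothing of \<open>H(X\<^sub>v)\<close>
  is lost, because \<open>X\<^sub>v\<close> is a measurable function of the sample and finitely many bits therefore determine
  it up to arbitrarily small conditional entropy (\<open>conditional_entropy_vanishes\<close>).
\<close>

section \<open>Entropy inequalities for finite-valued random variables\<close>

context prob_space begin

lemma information_space_nats: "information_space M (exp 1)"
  by unfold_locales simp

text \<open>
  Summing over the values of a finer variable \<open>T\<close> puts the entropies of several functions of \<open>T\<close> over
  one common index set, where they can be compared term by term.
\<close>

lemma entropy_determined_sum:
  assumes T: "simple_function M T" 
  shows "shannon_entropy M (\<lambda>\<omega>. f (T \<omega>)) =
    - (\<Sum>t\<in>T ` space M. prob (T -` {t} \<inter> space M) * ln (prob ((\<lambda>\<omega>. f (T \<omega>)) -` {f t} \<inter> space M)))"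
proof -
  interpret information_space M "exp 1" by (rule information_space_nats)
  let ?Y = "\<lambda>\<omega>. f (T \<omega>)"
  let ?q = "\<lambda>y. prob (?Y -` {y} \<inter> space M)"
  have fin: "finite (T ` space M)" using T by (simp add: simple_functionD)
  have Y: "simple_function M ?Y"
    using simple_function_compose[OF T, of f] by (simp add: comp_def)
  have "(\<Sum>t\<in>T ` space M. prob (T -` {t} \<inter> space M) * ln (?q (f t)))
      = (\<Sum>y\<in>f ` (T ` space M). \<Sum>t\<in>{t\<in>T ` space M. f t = y}. prob (T -` {t} \<inter> space M) * ln (?q (f t)))"
    using fin by (rule sum.image_gen)
  also have "\<dots> = (\<Sum>y\<in>?Y ` space M. ?q y * ln (?q y))"
    unfolding image_image
  proof (rule sum.cong[OF refl])
    fix y assume "y \<in> ?Y ` space M"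
    have "?q y = prob (\<Union>t\<in>{t\<in>T ` space M. f t = y}. T -` {t} \<inter> space M)"
      by (rule arg_cong[of _ _ prob]) auto
    also have "\<dots> = (\<Sum>t\<in>{t\<in>T ` space M. f t = y}. prob (T -` {t} \<inter> space M))"
      using fin simple_functionD(2)[OF T]
      by (intro finite_measure_finite_Union) (auto simp: disjoint_family_on_def)
    finally show "(\<Sum>t | t \<in> T ` space M \<and> f t = y. prob (T -` {t} \<inter> space M) * ln (?q (f t))) = ?q y * ln (?q y)"
      by (simp add: sum_distrib_right)
  qed
  also have "\<dots> = - shannon_entropy M ?Y"
    unfolding shannon_entropy_def
    by (subst entropy_simple_distributed[OF simple_distributedI[OF Y measure_nonneg refl]]) (simp add: log_def)
  finally show ?thesis by simp
qed

text \<open>Two variables with equal laws may still have different ranges, by values of probability zero.\<close>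

lemma entropy_sum_superset:
  assumes Y: "simple_function M Y" and R: "finite R" "Y ` space M \<subseteq> R"
  shows "shannon_entropy M Y = - (\<Sum>y\<in>R. prob (Y -` {y} \<inter> space M) * ln (prob (Y -` {y} \<inter> space M)))"
proof -
  have "Y -` {y} \<inter> space M = {}" if "y \<notin> Y ` space M" for y using that by auto
  then have "(\<Sum>y\<in>Y ` space M. prob (Y -` {y} \<inter> space M) * ln (prob (Y -` {y} \<inter> space M)))
    = (\<Sum>y\<in>R. prob (Y -` {y} \<inter> space M) * ln (prob (Y -` {y} \<inter> space M)))"
    using R by (intro sum.mono_neutral_left) auto
  then show ?thesis using entropy_determined_sum[OF Y, of "\<lambda>y. y"] by simp
qed

text \<open>
  Data processing, with the processing function replaced by the relation that it induces on outcomes.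
  Used in both directions, this identifies the entropies of different encodings of the same information.
\<close>

lemma entropy_mono_determined:
  assumes Y: "simple_function M Y"
    and det: "\<And>\<omega> \<omega>'. \<lbrakk>\<omega> \<in> space M; \<omega>' \<in> space M; Y \<omega> = Y \<omega>'\<rbrakk> \<Longrightarrow> X \<omega> = X \<omega>'"
  shows "shannon_entropy M X \<le> shannon_entropy M Y"
proof -
  interpret information_space M "exp 1" by (rule information_space_nats)
  define f where "f = X \<circ> inv_into (space M) Y"
  have X: "X \<omega> = (f \<circ> Y) \<omega>" if "\<omega> \<in> space M" for \<omega>
    using that unfolding f_def comp_def
    by (intro det) (auto simp: inv_into_into f_inv_into_f)
  have "X ` space M = (f \<circ> Y) ` space M" 
    by (rule image_cong[OF refl X])
  moreover have "distr M S X = distr M S (f \<circ> Y)" for S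
    by (rule distr_cong[OF refl refl X])
  ultimately have "shannon_entropy M X = shannon_entropy M (f \<circ> Y)"
    by (simp only: shannon_entropy_def entropy_def)
  then show ?thesis using entropy_data_processing[OF Y, of f] by (simp only: shannon_entropy_def)
qed

text \<open>The difference of the two sides is the conditional mutual information of \<open>X\<close> and \<open>Y\<close> given \<open>Z\<close>.\<close>

lemma entropy_submodular:
  assumes X: "simple_function M X" and Y: "simple_function M Y" and Z: "simple_function M Z"
  shows "shannon_entropy M (\<lambda>\<omega>. (X \<omega>, Y \<omega>, Z \<omega>)) + shannon_entropy M Z
    \<le> shannon_entropy M (\<lambda>\<omega>. (X \<omega>, Z \<omega>)) + shannon_entropy M (\<lambda>\<omega>. (Y \<omega>, Z \<omega>))"
proof -
  interpret information_space M "exp 1" by (rule information_space_nats)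
  let ?T = "\<lambda>\<omega>. (X \<omega>, Y \<omega>, Z \<omega>)"
  define p where "p t = prob (?T -` {t} \<inter> space M)" for t
  define pxz where "pxz t = prob ((\<lambda>\<omega>. (X \<omega>, Z \<omega>)) -` {t} \<inter> space M)" for t
  define pyz where "pyz t = prob ((\<lambda>\<omega>. (Y \<omega>, Z \<omega>)) -` {t} \<inter> space M)" for t
  define pz where "pz t = prob (Z -` {t} \<inter> space M)" for t
  have XZ: "simple_function M (\<lambda>\<omega>. (X \<omega>, Z \<omega>))" and YZ: "simple_function M (\<lambda>\<omega>. (Y \<omega>, Z \<omega>))"
    and T: "simple_function M ?T"
    using X Y Z by (auto intro: simple_function_Pair)
  have pos: "p (x, y, z) \<le> pxz (x, z) \<and> p (x, y, z) \<le> pyz (y, z) \<and> p (x, y, z) \<le> pz z" for x y z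
    unfolding p_def pxz_def pyz_def pz_def
    using simple_functionD(2)[OF XZ] simple_functionD(2)[OF YZ] simple_functionD(2)[OF Z]
    by (intro conjI finite_measure_mono) auto
  have "0 \<le> conditional_mutual_information (exp 1)
      (count_space (X ` space M)) (count_space (Y ` space M)) (count_space (Z ` space M)) X Y Z"
    by (rule conditional_mutual_information_nonneg[OF X Y Z])
  also have "\<dots> = (\<Sum>t\<in>?T ` space M. p t * ln (p t / (pxz (fst t, snd (snd t)) * (pyz (snd t) / pz (snd (snd t))))))"
    by (subst conditional_mutual_information_eq[where Pz=pz and Pyz=pyz and Pxz=pxz and Pxyz=p])
       (auto simp: p_def pxz_def pyz_def pz_def log_def intro!: simple_distributedI X Y Z XZ YZ T sum.cong)
  also have "\<dots> = (\<Sum>t\<in>?T ` space M. p t * ln (p t) - p t * ln (pxz (fst t, snd (snd t)))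
      - p t * ln (pyz (snd t)) + p t * ln (pz (snd (snd t))))"
  proof (rule sum.cong[OF refl])
    fix t assume "t \<in> ?T ` space M"
    obtain x y z where t: "t = (x, y, z)" by (cases t)
    have "p t = 0 \<or> 0 < p t" by (simp add: p_def zero_less_measure_iff)
    then show "p t * ln (p t / (pxz (fst t, snd (snd t)) * (pyz (snd t) / pz (snd (snd t))))) =
       p t * ln (p t) - p t * ln (pxz (fst t, snd (snd t)))
      - p t * ln (pyz (snd t)) + p t * ln (pz (snd (snd t)))"
    proof
      assume "0 < p t"
      then have "0 < p t" "0 < pxz (x, z)" "0 < pyz (y, z)" "0 < pz z" using pos[of x y z] t by auto
      then show ?thesis by (simp add: t ln_div ln_mult algebra_simps)
    qed simp
  qed
  also have "\<dots> = - shannon_entropy M ?T + shannon_entropy M (\<lambda>\<omega>. (X \<omega>, Z \<omega>))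
      + shannon_entropy M (\<lambda>\<omega>. (Y \<omega>, Z \<omega>)) - shannon_entropy M Z"
    using entropy_determined_sum[OF T, of "\<lambda>t. t"] entropy_determined_sum[OF T, of "\<lambda>t. (fst t, snd (snd t))"]
      entropy_determined_sum[OF T, of snd] entropy_determined_sum[OF T, of "\<lambda>t. snd (snd t)"]
    by (simp add: p_def pxz_def pyz_def pz_def sum.distrib sum_subtractf)
  finally show ?thesis by simp
qed

lemma entropy_indep:
  assumes X: "simple_function M X" and Y: "simple_function M Y"
    and ind: "\<And>x y. prob ((X -` {x} \<inter> space M) \<inter> (Y -` {y} \<inter> space M)) = prob (X -` {x} \<inter> space M) * prob (Y -` {y} \<inter> space M)"
  shows "shannon_entropy M (\<lambda>\<omega>. (X \<omega>, Y \<omega>)) = shannon_entropy M X + shannon_entropy M Y"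
proof -
  let ?T = "\<lambda>\<omega>. (X \<omega>, Y \<omega>)"
  define p where "p t = prob (?T -` {t} \<inter> space M)" for t
  define px where "px x = prob (X -` {x} \<inter> space M)" for x
  define py where "py y = prob (Y -` {y} \<inter> space M)" for y
  have T: "simple_function M ?T" using X Y by (rule simple_function_Pair)
  have p: "p t = px (fst t) * py (snd t)" for t
    unfolding p_def px_def py_def ind[symmetric]
    by (rule arg_cong[of _ _ prob]) auto
  have "(\<Sum>t\<in>?T ` space M. p t * ln (p t)) = (\<Sum>t\<in>?T ` space M. p t * ln (px (fst t)) + p t * ln (py (snd t)))"
  proof (rule sum.cong[OF refl])
    fix t
    have "p t = 0 \<or> (0 < px (fst t) \<and> 0 < py (snd t))"
      by (auto simp: p px_def py_def zero_less_measure_iff)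
    then show "p t * ln (p t) = p t * ln (px (fst t)) + p t * ln (py (snd t))"
      by (auto simp: p ln_mult algebra_simps)
  qed
  then show ?thesis
    using entropy_determined_sum[OF T, of "\<lambda>t. t"] entropy_determined_sum[OF T, of fst]
      entropy_determined_sum[OF T, of snd]
    by (simp add: p_def px_def py_def sum.distrib)
qed

lemma entropy_const: "shannon_entropy M (\<lambda>_. c) = 0"
proof -
  have "(\<lambda>_. c) -` {c} \<inter> space M = space M" by auto
  moreover have "(\<lambda>_. c) ` space M \<subseteq> {c}" by auto
  ultimately show ?thesis
    using entropy_sum_superset[of "\<lambda>_. c" "{c}"] by (simp add: prob_space)
qed

lemma entropy_Pair_le:
  assumes X: "simple_function M X" and Y: "simple_function M Y"
  shows "shannon_entropy M (\<lambda>\<omega>. (X \<omega>, Y \<omega>)) \<le> shannon_entropy M X + shannon_entropy M Y"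
proof -
  let ?c = "\<lambda>_. ()"
  have c: "simple_function M ?c" by simp
  have "shannon_entropy M (\<lambda>\<omega>. (X \<omega>, Y \<omega>)) \<le> shannon_entropy M (\<lambda>\<omega>. (X \<omega>, Y \<omega>, ()))"
    using X Y c by (intro entropy_mono_determined simple_function_Pair) auto
  also have "\<dots> \<le> shannon_entropy M (\<lambda>\<omega>. (X \<omega>, ())) + shannon_entropy M (\<lambda>\<omega>. (Y \<omega>, ()))"
    using entropy_submodular[OF X Y c] entropy_const[of "()"] by simp
  also have "\<dots> \<le> shannon_entropy M X + shannon_entropy M Y"
    using X Y by (intro add_mono entropy_mono_determined) auto
  finally show ?thesis .
qed

lemma entropy_same_law:
  assumes f: "f \<in> M \<rightarrow>\<^sub>M N" and g: "g \<in> M \<rightarrow>\<^sub>M N" and law: "distr M N f = distr M N g"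
    and hf: "simple_function M (\<lambda>\<omega>. h (f \<omega>))" and hg: "simple_function M (\<lambda>\<omega>. h (g \<omega>))"
    and h: "\<And>y. {z\<in>space N. h z = y} \<in> sets N"
  shows "shannon_entropy M (\<lambda>\<omega>. h (f \<omega>)) = shannon_entropy M (\<lambda>\<omega>. h (g \<omega>))"
proof -
  have p: "prob ((\<lambda>\<omega>. h (e \<omega>)) -` {y} \<inter> space M) = measure (distr M N e) {z\<in>space N. h z = y}"
    if e: "e \<in> M \<rightarrow>\<^sub>M N" for e y
    using measurable_space[OF e]
    by (subst measure_distr[OF e h]) (auto intro!: arg_cong[of _ _ prob])
  let ?R = "(\<lambda>\<omega>. h (f \<omega>)) ` space M \<union> (\<lambda>\<omega>. h (g \<omega>)) ` space M"
  have R: "finite ?R" using hf hg by (simp add: simple_functionD)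
  show ?thesis
    using R by (simp add: entropy_sum_superset[OF hf R] entropy_sum_superset[OF hg R] p[OF f] p[OF g] law)
qed

text \<open>
  For the probability \<open>p\<close> of \<open>D\<close>, the bound \<open>ln x \<le> x - 1\<close> gives \<open>- p ln p \<le> 2 \<surd>p\<close> at \<open>x = 1 / \<surd>p\<close>
  and \<open>- (1 - p) ln (1 - p) \<le> p\<close> at \<open>x = 1 / (1 - p)\<close>.
\<close>

lemma binary_entropy_le:
  assumes D: "simple_function M (D :: 'a \<Rightarrow> bool)"
  shows "shannon_entropy M D \<le> 3 * sqrt (prob {\<omega>\<in>space M. D \<omega>})"
proof -
  define p where "p = prob {\<omega>\<in>space M. D \<omega>}"
  have "D -` {True} \<inter> space M = {\<omega>\<in>space M. D \<omega>}" by auto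
  then have ev: "{\<omega>\<in>space M. D \<omega>} \<in> events" using simple_functionD(2)[OF D, of "{True}"] by (simp only:)
  have p: "0 \<le> p" "p \<le> 1" by (auto simp: p_def)
  have "D -` {True} \<inter> space M = {\<omega>\<in>space M. D \<omega>}" "D -` {False} \<inter> space M = space M - {\<omega>\<in>space M. D \<omega>}"
    by auto
  then have "prob (D -` {True} \<inter> space M) = p" "prob (D -` {False} \<inter> space M) = 1 - p"
    using prob_compl[OF ev] by (simp_all only: p_def)
  then have "shannon_entropy M D = - (p * ln p + (1 - p) * ln (1 - p))"
    using entropy_sum_superset[OF D, of "{True, False}"] by auto
  moreover have "- (p * ln p) \<le> 2 * sqrt p"
  proof (cases "p = 0")
    case False
    define s where "s = sqrt p"
    have s: "0 < s" "p = s * s" using p False by (simp_all add: s_def)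
    have "ln (1 / s) \<le> 1 / s - 1" using s(1) by (intro ln_le_minus_one) simp
    then have "- ln s \<le> 1 / s" using s(1) by (simp add: ln_div)
    then have "(2 * (s * s)) * (- ln s) \<le> (2 * (s * s)) * (1 / s)"
      using s(1) by (intro mult_left_mono) simp_all
    then have "- (s * s * (ln s + ln s)) \<le> 2 * s"
      using s(1) by (simp add: algebra_simps)
    then show ?thesis using s by (simp add: ln_mult s_def[symmetric])
  qed simp
  moreover have "- ((1 - p) * ln (1 - p)) \<le> p"
  proof (cases "p = 1")
    case False
    then have "0 < 1 - p" using p by simp
    then have "ln (1 / (1 - p)) \<le> 1 / (1 - p) - 1" by (intro ln_le_minus_one) simp
    then have "- ln (1 - p) \<le> 1 / (1 - p) - 1" using \<open>0 < 1 - p\<close> by (simp add: ln_div)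
    then have "(1 - p) * (- ln (1 - p)) \<le> (1 - p) * (1 / (1 - p) - 1)"
      using \<open>0 < 1 - p\<close> by (intro mult_left_mono) simp_all
    also have "\<dots> = p" using \<open>0 < 1 - p\<close> by (simp add: right_diff_distrib)
    finally show ?thesis by simp
  qed simp
  moreover have "p \<le> sqrt p" using p by (simp add: real_le_rsqrt power2_eq_square mult_left_le)
  ultimately show ?thesis by (simp add: p_def)
qed

end

section \<open>The entropy polymatroid of a family of labels\<close>

locale label_family = prob_space M for M :: "'w measure" +
  fixes Y :: "'i \<Rightarrow> 'w \<Rightarrow> 'a" and I :: "'i set"
  assumes simple_label: "j \<in> I \<Longrightarrow> simple_function M (Y j)"
begin

definition joint_entropy :: "'i set \<Rightarrow> real" where
  "joint_entropy B = shannon_entropy M (joint_label Y B)"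

text \<open>The mutual information of the labels on \<open>B\<close> and those on \<open>C\<close>.\<close>

definition shared_information :: "'i set \<Rightarrow> 'i set \<Rightarrow> real" where
  "shared_information B C = joint_entropy B + joint_entropy C - joint_entropy (B \<union> C)"

lemma simple_joint_label:
  assumes "finite B" "B \<subseteq> I"
  shows "simple_function M (joint_label Y B)"
  using assms
proof (induction B rule: finite_induct)
  case empty
  then show ?case by (simp add: joint_label_def)
next
  case (insert j B)
  have "joint_label Y (insert j B) = (\<lambda>\<omega>. (joint_label Y B \<omega>)(j := Y j \<omega>))"
    by (auto simp: joint_label_def fun_eq_iff)
  moreover have "simple_function M (\<lambda>\<omega>. (joint_label Y B \<omega>)(j := Y j \<omega>))"
    using insert by (intro simple_function_compose2[where h="\<lambda>f y. f(j := y)"] simple_label) auto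
  ultimately show ?case by (simp only:)
qed

lemma joint_label_eq_iff: "joint_label Y B \<omega> = joint_label Y B \<omega>' \<longleftrightarrow> (\<forall>j\<in>B. Y j \<omega> = Y j \<omega>')"
  by (auto simp: joint_label_def restrict_def fun_eq_iff)

lemma joint_entropy_mono:
  assumes "finite C" "C \<subseteq> I" "B \<subseteq> C"
  shows "joint_entropy B \<le> joint_entropy C"
  unfolding joint_entropy_def using assms
  by (intro entropy_mono_determined simple_joint_label) (auto simp: joint_label_eq_iff)

lemma joint_entropy_empty: "joint_entropy {} = 0"
  using entropy_const[of "\<lambda>_. undefined"] by (simp add: joint_entropy_def joint_label_def[abs_def] restrict_def)

lemma joint_entropy_nonneg:
  assumes "finite B" "B \<subseteq> I"
  shows "0 \<le> joint_entropy B"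
  using joint_entropy_mono[OF assms, of "{}"] joint_entropy_empty by simp

text \<open>Submodularity of Shannon entropy, conditioning on the labels that \<open>B\<close> and \<open>C\<close> have in common.\<close>

lemma joint_entropy_submodular:
  assumes "finite B" "B \<subseteq> I" "finite C" "C \<subseteq> I"
  shows "joint_entropy (B \<union> C) + joint_entropy (B \<inter> C) \<le> joint_entropy B + joint_entropy C"
proof -
  let ?L = "joint_label Y"
  have s: "simple_function M (?L B)" "simple_function M (?L C)" "simple_function M (?L (B \<inter> C))"
    using assms by (auto intro!: simple_joint_label)
  have "shannon_entropy M (?L (B \<union> C)) \<le> shannon_entropy M (\<lambda>\<omega>. (?L B \<omega>, ?L C \<omega>, ?L (B \<inter> C) \<omega>))"
    using s by (intro entropy_mono_determined simple_function_Pair) (auto simp: joint_label_eq_iff)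
  moreover have "shannon_entropy M (\<lambda>\<omega>. (?L B \<omega>, ?L (B \<inter> C) \<omega>)) \<le> shannon_entropy M (?L B)"
    "shannon_entropy M (\<lambda>\<omega>. (?L C \<omega>, ?L (B \<inter> C) \<omega>)) \<le> shannon_entropy M (?L C)"
    using s by (intro entropy_mono_determined; auto simp: joint_label_eq_iff)+
  ultimately show ?thesis
    using entropy_submodular[OF s] unfolding joint_entropy_def by linarith
qed

lemma joint_entropy_singleton:
  assumes "j \<in> I"
  shows "joint_entropy {j} = shannon_entropy M (Y j)"
  unfolding joint_entropy_def using assms
  by (intro antisym entropy_mono_determined simple_joint_label simple_label)
     (auto simp: joint_label_eq_iff)

lemma joint_entropy_le_sum:
  assumes "finite B" "B \<subseteq> I"
  shows "joint_entropy B \<le> (\<Sum>j\<in>B. shannon_entropy M (Y j))"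
  using assms
proof (induction B rule: finite_induct)
  case (insert j B)
  then show ?case
    using joint_entropy_submodular[of B "{j}"] joint_entropy_singleton[of j]
    by (simp add: joint_entropy_empty)
qed (simp add: joint_entropy_empty)

lemma shared_information_commute: "shared_information B C = shared_information C B"
  by (simp add: shared_information_def Un_commute)

lemma shared_information_mono_left:
  assumes "finite B'" "B' \<subseteq> I" "finite C" "C \<subseteq> I" "B \<subseteq> B'"
  shows "shared_information B C \<le> shared_information B' C"
proof -
  have "joint_entropy (B' \<union> (B \<union> C)) + joint_entropy (B' \<inter> (B \<union> C)) \<le> joint_entropy B' + joint_entropy (B \<union> C)"
    using assms by (intro joint_entropy_submodular) (auto intro: finite_subset)
  moreover have "joint_entropy B \<le> joint_entropy (B' \<inter> (B \<union> C))"
    using assms by (intro joint_entropy_mono) auto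
  moreover have "B' \<union> (B \<union> C) = B' \<union> C" using assms by auto
  ultimately show ?thesis by (simp add: shared_information_def)
qed

lemma shared_information_mono:
  assumes "finite B'" "B' \<subseteq> I" "finite C'" "C' \<subseteq> I" "B \<subseteq> B'" "C \<subseteq> C'"
  shows "shared_information B C \<le> shared_information B' C'"
proof -
  have "shared_information B C \<le> shared_information B' C"
    using assms by (intro shared_information_mono_left) (auto intro: finite_subset)
  also have "\<dots> \<le> shared_information B' C'"
    using assms shared_information_mono_left[of C' B' C] by (simp add: shared_information_commute)
  finally show ?thesis .
qed

lemma shared_information_nonneg:
  assumes "finite B" "B \<subseteq> I" "finite C" "C \<subseteq> I"
  shows "0 \<le> shared_information B C"
  using shared_information_mono[OF assms, of "{}" "{}"]
  by (simp add: shared_information_def joint_entropy_empty)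

lemma shared_information_indep:
  assumes "finite B" "B \<subseteq> I" "finite C" "C \<subseteq> I"
    and ind: "\<And>b c. prob {\<omega>\<in>space M. (\<forall>j\<in>B. Y j \<omega> = b j) \<and> (\<forall>j\<in>C. Y j \<omega> = c j)}
       = prob {\<omega>\<in>space M. \<forall>j\<in>B. Y j \<omega> = b j} * prob {\<omega>\<in>space M. \<forall>j\<in>C. Y j \<omega> = c j}"
  shows "shared_information B C = 0"
proof -
  have ev: "joint_label Y D -` {d} \<inter> space M = {\<omega>\<in>space M. d \<in> extensional D \<and> (\<forall>j\<in>D. Y j \<omega> = d j)}" for D d
    by (auto simp: joint_label_def extensional_def restrict_def fun_eq_iff)
  have "prob ((joint_label Y B -` {b} \<inter> space M) \<inter> (joint_label Y C -` {c} \<inter> space M))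
       = prob (joint_label Y B -` {b} \<inter> space M) * prob (joint_label Y C -` {c} \<inter> space M)" for b c
  proof (cases "b \<in> extensional B \<and> c \<in> extensional C")
    case True
    then have "prob ((joint_label Y B -` {b} \<inter> space M) \<inter> (joint_label Y C -` {c} \<inter> space M))
      = prob {\<omega>\<in>space M. (\<forall>j\<in>B. Y j \<omega> = b j) \<and> (\<forall>j\<in>C. Y j \<omega> = c j)}"
      unfolding ev by (intro arg_cong[of _ _ prob]) auto
    with True show ?thesis by (simp add: ev ind)
  next
    case False
    then show ?thesis unfolding ev by (auto simp del: vimage_const)
  qed
  note ind' = this
  have s: "simple_function M (joint_label Y B)" "simple_function M (joint_label Y C)" "simple_function M (joint_label Y (B \<union> C))"
    using assms by (auto intro!: simple_joint_label)
  have "shannon_entropy M (joint_label Y (B \<union> C)) = shannon_entropy M (\<lambda>\<omega>. (joint_label Y B \<omega>, joint_label Y C \<omega>))"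
    using s by (intro antisym entropy_mono_determined simple_function_Pair) (auto simp: joint_label_eq_iff)
  then show ?thesis
    using entropy_indep[OF s(1,2) ind'] by (simp add: shared_information_def joint_entropy_def)
qed

end

section \<open>Shapley averages\<close>

text \<open>
  The probability, in a uniformly random order of \<open>n + 1\<close> players, that exactly the members of a given
  set of \<open>k\<close> of them come before a given other player.
\<close>

definition shapley_weight :: "nat \<Rightarrow> nat \<Rightarrow> real" where
  "shapley_weight n k = fact k * fact (n - k) / fact (Suc n)"

text \<open>
  The players in \<open>N\<close> are ordered at random together with one further player \<open>u \<notin> N\<close>: this is the expectation of
  \<open>D\<close> at the random set of those members of \<open>N\<close> that come before \<open>u\<close>.
\<close>

definition shapley_average :: "'v set \<Rightarrow> ('v set \<Rightarrow> real) \<Rightarrow> real" where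
  "shapley_average N D = (\<Sum>A\<in>Pow N. shapley_weight (card N) (card A) * D A)"

lemma shapley_weight_nonneg: "0 \<le> shapley_weight n k"
  by (simp add: shapley_weight_def)

text \<open>The two summands separate the orders according to whether an additional player comes after or before.\<close>

lemma shapley_weight_split:
  assumes "k \<le> n"
  shows "shapley_weight n k = shapley_weight (Suc n) k + shapley_weight (Suc n) (Suc k)"
proof -
  have e: "fact (Suc n - k) = (real (n - k) + 1) * fact (n - k)" "fact (Suc (Suc n)) = (real n + 2) * fact (Suc n)"
    "fact (Suc k) = (real k + 1) * fact k"
    using assms by (auto simp: Suc_diff_le algebra_simps)
  have "shapley_weight (Suc n) k + shapley_weight (Suc n) (Suc k)
      = fact k * fact (n - k) * ((real (n - k) + 1) + (real k + 1)) / ((real n + 2) * fact (Suc n))"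
    unfolding shapley_weight_def diff_Suc_Suc e by (simp add: add_divide_distrib algebra_simps del: fact_Suc)
  also have "(real (n - k) + 1) + (real k + 1) = real n + 2" using assms by simp
  finally show ?thesis by (simp add: shapley_weight_def del: fact_Suc)
qed

lemma shapley_weight_balance:
  assumes "0 < b" "b < n"
  shows "real b * shapley_weight (n - 1) (b - 1) = real (n - b) * shapley_weight (n - 1) b"
proof -
  obtain c where b: "b = Suc c" using assms(1) by (cases b) auto
  obtain d where n: "n = Suc (b + d)" using less_imp_Suc_add[OF assms(2)] by auto
  show ?thesis by (simp add: b n shapley_weight_def)
qed

text \<open>With more players, the set of those that come before \<open>u\<close> in a random order can only grow.\<close>

lemma shapley_average_mono_set:
  assumes "finite N'" "N \<subseteq> N'"
    and D: "\<And>A w. \<lbrakk>A \<subseteq> N'; w \<in> N'\<rbrakk> \<Longrightarrow> D A \<le> D (insert w A)"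
  shows "shapley_average N D \<le> shapley_average N' D"
proof -
  have step: "shapley_average K D \<le> shapley_average (insert w K) D"
    if K: "insert w K \<subseteq> N'" "w \<notin> K" for w K
  proof -
    have fin: "finite K" using K assms(1) finite_subset by auto
    have inj: "inj_on (insert w) (Pow K)" using K(2) by (auto simp: inj_on_def)
    have card: "card (insert w A) = Suc (card A)" if "A \<in> Pow K" for A
      using that fin K(2) by (intro card_insert_disjoint) (auto intro: finite_subset)
    have card_le: "card A \<le> card K" if "A \<in> Pow K" for A
      using that fin by (intro card_mono) auto
    have "shapley_average K D = (\<Sum>A\<in>Pow K. shapley_weight (Suc (card K)) (card A) * D A
        + shapley_weight (Suc (card K)) (Suc (card A)) * D A)"
      unfolding shapley_average_def
      by (intro sum.cong refl) (simp only: shapley_weight_split[OF card_le] ring_distribs)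
    also have "\<dots> \<le> (\<Sum>A\<in>Pow K. shapley_weight (Suc (card K)) (card A) * D A
        + shapley_weight (Suc (card K)) (Suc (card A)) * D (insert w A))"
      using K by (intro sum_mono add_left_mono mult_left_mono[OF D shapley_weight_nonneg]) auto
    also have "\<dots> = (\<Sum>A\<in>Pow K. shapley_weight (card (insert w K)) (card A) * D A)
        + (\<Sum>A\<in>insert w ` Pow K. shapley_weight (card (insert w K)) (card A) * D A)"
    proof -
      have "(\<Sum>A\<in>insert w ` Pow K. shapley_weight (card (insert w K)) (card A) * D A)
          = (\<Sum>A\<in>Pow K. shapley_weight (Suc (card K)) (Suc (card A)) * D (insert w A))"
        unfolding sum.reindex[OF inj] comp_def using card fin K(2) by (intro sum.cong refl) simp
      then show ?thesis using fin K(2) by (simp add: sum.distrib)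
    qed
    also have "\<dots> = shapley_average (insert w K) D"
      unfolding shapley_average_def Pow_insert
      using fin K(2) by (intro sum.union_disjoint[symmetric]) auto
    finally show ?thesis .
  qed
  have "shapley_average N D \<le> shapley_average (N \<union> K) D" if "finite K" "K \<subseteq> N' - N" for K
    using that
  proof (induction K rule: finite_induct)
    case (insert w K)
    then have "shapley_average (N \<union> K) D \<le> shapley_average (insert w (N \<union> K)) D"
      using assms(2) by (intro step) auto
    with insert show ?case by simp
  qed simp
  from this[of "N' - N"] show ?thesis using assms(1,2) by (simp add: Un_absorb1)
qed

lemma shapley_average_mono:
  assumes "\<And>A. A \<subseteq> N \<Longrightarrow> D A \<le> D' A"
  shows "shapley_average N D \<le> shapley_average N D'"
  unfolding shapley_average_def
  using assms by (intro sum_mono mult_left_mono shapley_weight_nonneg) auto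

lemma shapley_average_zero: "(\<And>A. A \<subseteq> N \<Longrightarrow> D A = 0) \<Longrightarrow> shapley_average N D = 0"
  unfolding shapley_average_def by (intro sum.neutral) auto

lemma shapley_average_image:
  assumes "inj_on f N"
  shows "shapley_average (f ` N) D = shapley_average N (\<lambda>A. D (f ` A))"
proof -
  have "shapley_average (f ` N) D
      = (\<Sum>A\<in>Pow N. shapley_weight (card (f ` N)) (card (f ` A)) * D (f ` A))"
    unfolding shapley_average_def image_Pow_surj[OF refl, symmetric]
    using assms by (subst sum.reindex) (auto simp: inj_on_image_Pow comp_def)
  also have "\<dots> = shapley_average N (\<lambda>A. D (f ` A))"
    unfolding shapley_average_def using assms
    by (intro sum.cong refl) (auto simp: card_image inj_on_subset)
  finally show ?thesis .
qed

lemma shapley_average_cong: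
  "(\<And>A. A \<subseteq> N \<Longrightarrow> D A = D' A) \<Longrightarrow> shapley_average N D = shapley_average N D'"
  unfolding shapley_average_def by (intro sum.cong) auto

text \<open>
  The increments along any single order telescope to \<open>F N - F {}\<close>. In terms of the weights: the value
  \<open>F B\<close> enters once for each \<open>u \<in> B\<close> and is subtracted once for each \<open>u \<notin> B\<close>, and by
  \<open>shapley_weight_balance\<close> these contributions cancel unless \<open>B\<close> is empty or all of \<open>N\<close>.
\<close>

lemma shapley_efficient:
  assumes fin: "finite N"
  shows "(\<Sum>u\<in>N. shapley_average (N - {u}) (\<lambda>A. F (insert u A) - F A)) = F N - F {}"
proof -
  let ?n = "card N"
  let ?w = "shapley_weight (?n - 1)"
  have joined: "(\<Sum>u\<in>N. \<Sum>A\<in>Pow (N - {u}). ?w (card A) * F (insert u A))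
      = (\<Sum>B\<in>Pow N. real (card B) * ?w (card B - 1) * F B)"
  proof -
    have "(\<Sum>u\<in>N. \<Sum>A\<in>Pow (N - {u}). ?w (card A) * F (insert u A))
        = (\<Sum>u\<in>N. \<Sum>B\<in>{B\<in>Pow N. u \<in> B}. ?w (card B - 1) * F B)"
    proof (rule sum.cong[OF refl])
      fix u assume u: "u \<in> N"
      show "(\<Sum>A\<in>Pow (N - {u}). ?w (card A) * F (insert u A)) = (\<Sum>B\<in>{B\<in>Pow N. u \<in> B}. ?w (card B - 1) * F B)"
        by (rule sum.reindex_bij_witness[where i="\<lambda>B. B - {u}" and j="insert u"])
           (use u fin in \<open>auto simp: insert_absorb card_insert_if finite_subset subset_insert_iff\<close>)
    qed
    also have "\<dots> = (\<Sum>B\<in>Pow N. \<Sum>u\<in>{u\<in>N. u \<in> B}. ?w (card B - 1) * F B)"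
      using fin by (intro sum.swap_restrict) auto
    also have "\<dots> = (\<Sum>B\<in>Pow N. real (card B) * ?w (card B - 1) * F B)"
      by (intro sum.cong) (auto simp: Collect_conj_eq inf.absorb2 intro!: arg_cong[of _ _ card])
    finally show ?thesis .
  qed
  have unjoined: "(\<Sum>u\<in>N. \<Sum>A\<in>Pow (N - {u}). ?w (card A) * F A)
      = (\<Sum>B\<in>Pow N. real (?n - card B) * ?w (card B) * F B)"
  proof -
    have "(\<Sum>u\<in>N. \<Sum>A\<in>Pow (N - {u}). ?w (card A) * F A)
        = (\<Sum>u\<in>N. \<Sum>B\<in>{B\<in>Pow N. u \<notin> B}. ?w (card B) * F B)"
      by (intro sum.cong) auto
    also have "\<dots> = (\<Sum>B\<in>Pow N. \<Sum>u\<in>{u\<in>N. u \<notin> B}. ?w (card B) * F B)"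
      using fin by (intro sum.swap_restrict) auto
    also have "\<dots> = (\<Sum>B\<in>Pow N. real (?n - card B) * ?w (card B) * F B)"
    proof (intro sum.cong[OF refl])
      fix B assume "B \<in> Pow N"
      then have "{u\<in>N. u \<notin> B} = N - B" "card (N - B) = ?n - card B"
        using fin by (auto simp: card_Diff_subset finite_subset)
      then show "(\<Sum>u\<in>{u\<in>N. u \<notin> B}. ?w (card B) * F B) = real (?n - card B) * ?w (card B) * F B"
        by simp
    qed
    finally show ?thesis .
  qed
  define c where "c B = real (card B) * ?w (card B - 1) - real (?n - card B) * ?w (card B)" for B :: "'a set"
  have "(\<Sum>u\<in>N. shapley_average (N - {u}) (\<lambda>A. F (insert u A) - F A)) = (\<Sum>B\<in>Pow N. c B * F B)"
    unfolding shapley_average_def c_def using fin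
    by (simp add: right_diff_distrib left_diff_distrib sum_subtractf joined unjoined card_Diff_singleton del: One_nat_def)
  also have "\<dots> = F N - F {}"
  proof (cases "N = {}")
    case False
    then have n: "0 < ?n" using fin by (simp add: card_gt_0_iff)
    then have w: "real ?n * ?w (?n - 1) = 1" "real ?n * ?w 0 = 1"
      by (cases "?n"; simp add: shapley_weight_def)+
    have "(\<Sum>B\<in>Pow N. c B * F B) = (\<Sum>B\<in>{{}, N}. c B * F B)"
    proof (rule sum.mono_neutral_right)
      show "\<forall>B\<in>Pow N - {{}, N}. c B * F B = 0"
      proof
        fix B assume "B \<in> Pow N - {{}, N}"
        then have B: "B \<subset> N" "B \<noteq> {}" by auto
        then have "finite B" using fin by (metis finite_subset psubset_imp_subset)
        then have "0 < card B" "card B < ?n"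
          using B fin by (simp_all add: card_gt_0_iff psubset_card_mono)
        from shapley_weight_balance[OF this] show "c B * F B = 0" by (simp add: c_def)
      qed
    qed (use fin in auto)
    also have "\<dots> = F N - F {}" using False w by (simp add: c_def)
    finally show ?thesis .
  qed (simp add: c_def)
  finally show ?thesis .
qed

section \<open>Domination over level sets\<close>

text \<open>
  A layer-cake argument. If \<open>j\<close> is the indicator of a subset \<open>A\<close> of \<open>W\<close>, then \<open>g\<close> is at least \<open>1\<close> on the sets
  that meet \<open>A\<close>, and the claim is the last hypothesis. In general \<open>j\<close> is a positive combination of
  indicators of its superlevel sets. The induction removes the lowest layer: the minimum \<open>m\<close> of \<open>j\<close> on \<open>W\<close>
  is subtracted from \<open>j\<close> on \<open>W\<close> and from \<open>g\<close> on the sets that meet \<open>W\<close>, after which a vertex where the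
  minimum was attained can be dropped.
\<close>

lemma threshold_domination:
  fixes j :: "'v \<Rightarrow> real" and g \<alpha> :: "'v set \<Rightarrow> real"
  assumes "finite \<U>" "finite W"
    and "\<And>U. U \<in> \<U> \<Longrightarrow> 0 \<le> \<alpha> U"
    and "\<And>v. v \<in> W \<Longrightarrow> 0 \<le> j v" "\<And>U. U \<in> \<U> \<Longrightarrow> 0 \<le> g U"
    and "\<And>U v. \<lbrakk>U \<in> \<U>; v \<in> U \<inter> W\<rbrakk> \<Longrightarrow> j v \<le> g U"
    and "\<And>A. \<lbrakk>A \<subseteq> W; A \<noteq> {}\<rbrakk> \<Longrightarrow> \<beta> * real (card A) \<le> (\<Sum>U | U \<in> \<U> \<and> U \<inter> A \<noteq> {}. \<alpha> U)"
  shows "\<beta> * (\<Sum>v\<in>W. j v) \<le> (\<Sum>U\<in>\<U>. \<alpha> U * g U)"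
  using assms(2,4-)
proof (induction W arbitrary: j g rule: finite_psubset_induct)
  case (psubset W)
  show ?case
  proof (cases "W = {}")
    case True
    then show ?thesis using assms(3) psubset.prems(2) by (auto intro!: sum_nonneg)
  next
    case False
    then obtain v0 where v0: "v0 \<in> W" "\<And>v. v \<in> W \<Longrightarrow> j v0 \<le> j v"
      using arg_min_if_finite[OF psubset.hyps False, of j] by (meson linorder_not_less)
    define m where "m = j v0"
    define g' where "g' U = (if U \<inter> W \<noteq> {} then g U - m else g U)" for U
    have m: "m \<le> g U" if "U \<in> \<U>" "U \<inter> W \<noteq> {}" for U
      using that psubset.prems(3)[of U] v0(2) unfolding m_def by (meson Int_emptyI IntI order_trans)
    have "\<beta> * (\<Sum>v\<in>W - {v0}. j v - m) \<le> (\<Sum>U\<in>\<U>. \<alpha> U * g' U)"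
    proof (rule psubset.IH)
      show "W - {v0} \<subset> W" using v0 by auto
      show "0 \<le> j v - m" if "v \<in> W - {v0}" for v using that v0 by (simp add: m_def)
      show "0 \<le> g' U" if "U \<in> \<U>" for U using that m psubset.prems(2) by (simp add: g'_def)
      show "j v - m \<le> g' U" if "U \<in> \<U>" "v \<in> U \<inter> (W - {v0})" for U v
        using that psubset.prems(3)[of U v] by (auto simp: g'_def)
      show "\<beta> * real (card A) \<le> (\<Sum>U | U \<in> \<U> \<and> U \<inter> A \<noteq> {}. \<alpha> U)" if "A \<subseteq> W - {v0}" "A \<noteq> {}" for A
        using that by (intro psubset.prems(4)) auto
    qed
    moreover have "(\<Sum>v\<in>W - {v0}. j v - m) = (\<Sum>v\<in>W. j v) - m * real (card W)"
    proof -
      have "(\<Sum>v\<in>W. j v - m) = (\<Sum>v\<in>W - {v0}. j v - m)"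
        using v0(1) psubset.hyps by (simp add: sum.remove m_def)
      then show ?thesis by (simp add: sum_subtractf mult.commute)
    qed
    moreover have "(\<Sum>U\<in>\<U>. \<alpha> U * g' U) = (\<Sum>U\<in>\<U>. \<alpha> U * g U) - m * (\<Sum>U | U \<in> \<U> \<and> U \<inter> W \<noteq> {}. \<alpha> U)"
    proof -
      have "(\<Sum>U\<in>\<U>. \<alpha> U * g' U) = (\<Sum>U\<in>\<U>. \<alpha> U * g U - (if U \<inter> W \<noteq> {} then m * \<alpha> U else 0))"
        by (intro sum.cong) (auto simp: g'_def algebra_simps)
      then show ?thesis using assms(1)
        by (simp add: sum_subtractf sum_distrib_left flip: sum.inter_filter)
    qed
    moreover have "m * (\<beta> * real (card W)) \<le> m * (\<Sum>U | U \<in> \<U> \<and> U \<inter> W \<noteq> {}. \<alpha> U)"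
      using False v0(1) psubset.prems(1) by (intro mult_left_mono psubset.prems(4)) (auto simp: m_def)
    ultimately show ?thesis by (simp add: algebra_simps)
  qed
qed

section \<open>A factor of an IID process and its finite observations\<close>

lemma Collect_eq_sets:
  assumes "f \<in> N \<rightarrow>\<^sub>M count_space UNIV"
  shows "{z \<in> space N. f z = y} \<in> sets N"
  using measurable_sets[OF assms, of "{y}"] by (simp add: vimage_def Int_def conj_commute)

text \<open>
  A permutation of the vertices preserves the law of the process; for \<open>\<pi> = id\<close> this is the law itself.
\<close>

lemma (in prob_space) distr_sample:
  assumes iid: "iid_process M V Z" and V: "V \<noteq> {}" and \<pi>: "bij_betw \<pi> V V"
  shows "distr M (PiM V (\<lambda>_. unit_lborel)) (\<lambda>\<omega>. \<lambda>u\<in>V. Z (\<pi> u) \<omega>) = PiM V (\<lambda>_. unit_lborel)"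
proof -
  have Z: "indep_vars (\<lambda>_. unit_lborel) Z V" and law: "\<And>u. u \<in> V \<Longrightarrow> distr M unit_lborel (Z u) = unit_lborel"
    using iid by (auto simp: iid_process_def)
  have \<pi>V: "\<pi> u \<in> V" if "u \<in> V" for u using \<pi> that by (auto simp: bij_betw_def)
  have rv: "random_variable unit_lborel (Z u)" if "u \<in> V" for u
    using Z that by (auto simp: indep_vars_def)
  have "indep_vars (\<lambda>j. PiM {\<pi> j} (\<lambda>_. unit_lborel)) (\<lambda>j \<omega>. restrict (\<lambda>i. Z i \<omega>) {\<pi> j}) V"
    using Z \<pi> by (intro indep_vars_restrict) (auto simp: disjoint_family_on_def bij_betw_def inj_on_def)
  then have "indep_vars (\<lambda>_. unit_lborel) (\<lambda>j \<omega>. (restrict (\<lambda>i. Z i \<omega>) {\<pi> j}) (\<pi> j)) V"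
    by (rule indep_vars_compose2) (auto intro: measurable_component_singleton)
  then have "indep_vars (\<lambda>_. unit_lborel) (\<lambda>j. Z (\<pi> j)) V" by simp
  then have "distr M (PiM V (\<lambda>_. unit_lborel)) (\<lambda>\<omega>. \<lambda>u\<in>V. Z (\<pi> u) \<omega>)
      = PiM V (\<lambda>u. distr M unit_lborel (Z (\<pi> u)))"
    using V rv \<pi>V by (subst (asm) indep_vars_iff_distr_eq_PiM') auto
  also have "\<dots> = PiM V (\<lambda>_. unit_lborel)"
    using law \<pi>V by (intro PiM_cong) auto
  finally show ?thesis .
qed

text \<open>
  The labels are given by the factor map \<open>F\<close> applied to the sample, so that they are functions on
  \<open>[0,1]\<^sup>V\<close> and can be evaluated at a permuted sample.
\<close>

locale iid_factor = prob_space M for M :: "'w measure" +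
  fixes V :: "'v set" and Z :: "'v \<Rightarrow> 'w \<Rightarrow> real" and S :: "'s set"
    and F :: "('v \<Rightarrow> real) \<Rightarrow> 'v \<Rightarrow> 's"
  assumes countable_V: "countable V" and V_nonempty: "V \<noteq> {}"
    and iid: "iid_process M V Z" and finite_S: "finite S"
    and F_measurable: "F \<in> PiM V (\<lambda>_. unit_lborel) \<rightarrow>\<^sub>M PiM V (\<lambda>_. count_space S)"
begin

abbreviation cube :: "('v \<Rightarrow> real) measure" where
  "cube \<equiv> PiM V (\<lambda>_. unit_lborel)"

definition threshold :: "nat \<Rightarrow> real" where
  "threshold = from_nat_into \<rat>"

definition sample :: "'w \<Rightarrow> 'v \<Rightarrow> real" where
  "sample \<omega> = (\<lambda>u\<in>V. Z u \<omega>)"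

text \<open>
  Labels and bits are put into one family with one index type, so that joint entropies of any mixture
  of them are values of a single submodular set function. The index \<open>Inl v\<close> stands for the label at \<open>v\<close>, and
  \<open>Inr (a, i)\<close> for the bit that compares \<open>Z\<^sub>a\<close> with the \<open>i\<close>-th rational number.
\<close>

definition reading :: "'v + 'v \<times> nat \<Rightarrow> ('v \<Rightarrow> real) \<Rightarrow> 's + bool" where
  "reading j z = (case j of Inl v \<Rightarrow> Inl (F z v) | Inr (a, i) \<Rightarrow> Inr (z a < threshold i))"

definition observed :: "'v + 'v \<times> nat \<Rightarrow> 'w \<Rightarrow> 's + bool" where
  "observed j \<omega> = reading j (sample \<omega>)"

abbreviation indices :: "('v + 'v \<times> nat) set" where
  "indices \<equiv> V <+> V \<times> UNIV"

lemma Z_measurable: "u \<in> V \<Longrightarrow> Z u \<in> M \<rightarrow>\<^sub>M unit_lborel"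
  using iid by (auto simp: iid_process_def indep_vars_def)

lemma sample_measurable: "sample \<in> M \<rightarrow>\<^sub>M cube"
  unfolding sample_def[abs_def] by (intro measurable_restrict Z_measurable)

lemma F_in_S: "z \<in> space cube \<Longrightarrow> v \<in> V \<Longrightarrow> F z v \<in> S"
  using measurable_space[OF F_measurable, of z] by (auto simp: space_PiM)

lemma below_threshold_measurable: "{x \<in> space unit_lborel. x < c} \<in> sets unit_lborel"
  unfolding unit_lborel_def by (auto simp: space_restrict_space sets_restrict_space)

lemma bit_measurable:
  assumes "a \<in> K"
  shows "reading (Inr (a, i)) \<in> PiM K (\<lambda>_. unit_lborel) \<rightarrow>\<^sub>M count_space UNIV"
proof -
  have "(\<lambda>x. x < threshold i) \<in> unit_lborel \<rightarrow>\<^sub>M count_space UNIV"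
    using below_threshold_measurable[of "threshold i"] by (simp add: pred_def)
  then have "(\<lambda>z. Inr (z a < threshold i)) \<in> PiM K (\<lambda>_. unit_lborel) \<rightarrow>\<^sub>M (count_space UNIV :: ('s + bool) measure)"
    using assms by (intro measurable_compose[OF _ measurable_count_space, where g=Inr]
      measurable_compose[OF measurable_component_singleton, where g="\<lambda>x. x < threshold i"])
  then show ?thesis by (simp add: reading_def[abs_def])
qed

lemma reading_measurable:
  assumes "j \<in> indices"
  shows "reading j \<in> cube \<rightarrow>\<^sub>M count_space UNIV"
proof (cases j)
  case (Inl v)
  then have v: "v \<in> V" using assms by auto
  have "(\<lambda>z. F z v) \<in> cube \<rightarrow>\<^sub>M count_space S"
    using measurable_compose[OF F_measurable measurable_component_singleton[OF v]] .
  then have "(\<lambda>z. Inl (F z v)) \<in> cube \<rightarrow>\<^sub>M (count_space UNIV :: ('s + bool) measure)"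
    by (rule measurable_compose) simp
  then show ?thesis by (simp add: Inl reading_def[abs_def])
next
  case (Inr p)
  then show ?thesis using assms bit_measurable by (cases p) auto
qed

lemma simple_function_reading:
  assumes j: "j \<in> indices" and s: "s \<in> M \<rightarrow>\<^sub>M cube"
  shows "simple_function M (\<lambda>\<omega>. reading j (s \<omega>))"
proof -
  have "(\<lambda>\<omega>. reading j (s \<omega>)) ` space M \<subseteq> Inl ` S \<union> range Inr"
    using j measurable_space[OF s] by (auto simp: reading_def F_in_S split: sum.splits prod.splits)
  then have "finite ((\<lambda>\<omega>. reading j (s \<omega>)) ` space M)"
    by (rule finite_subset) (simp add: finite_S)
  moreover have "(\<lambda>\<omega>. reading j (s \<omega>)) \<in> M \<rightarrow>\<^sub>M count_space UNIV"
    using measurable_compose[OF s reading_measurable[OF j]] .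
  ultimately show ?thesis
    by (auto simp: simple_function_def intro: measurable_sets)
qed

sublocale label_family M observed indices
  by unfold_locales (simp add: observed_def[abs_def] simple_function_reading sample_measurable)

text \<open>The first \<open>k\<close> bits of each \<open>Z\<^sub>a\<close> with \<open>a \<in> A\<close>.\<close>

definition block :: "'v set \<Rightarrow> nat \<Rightarrow> ('v + 'v \<times> nat) set" where
  "block A k = Inr ` (A \<times> {..<k})"

lemma block_finite: "finite A \<Longrightarrow> finite (block A k)"
  by (simp add: block_def)

lemma block_indices: "A \<subseteq> V \<Longrightarrow> block A k \<subseteq> indices"
  by (auto simp: block_def)

lemma block_mono: "A \<subseteq> B \<Longrightarrow> k \<le> m \<Longrightarrow> block A k \<subseteq> block B m"
  by (auto simp: block_def)

lemma block_Un: "block (A \<union> B) k = block A k \<union> block B k"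
  by (auto simp: block_def)

definition relabel :: "('v \<Rightarrow> 'v) \<Rightarrow> 'v + 'v \<times> nat \<Rightarrow> 'v + 'v \<times> nat" where
  "relabel \<pi> = map_sum \<pi> (map_prod \<pi> id)"

lemma relabel_block: "relabel \<pi> ` block A k = block (\<pi> ` A) k"
  by (force simp: relabel_def block_def image_iff)

lemma relabel_Inl: "relabel \<pi> ` Inl ` U = Inl ` \<pi> ` U"
  by (auto simp: relabel_def image_image)

text \<open>
  By equivariance, reading the label or bit at the image of an index under \<open>\<pi>\<close> is the same as reading
  it at the index itself after permuting the sample, and permuting the sample does not change its law.
\<close>

lemma joint_entropy_relabel:
  assumes B: "finite B" "B \<subseteq> indices" and \<pi>: "bij_betw \<pi> V V"
    and equivariant: "\<And>z v. \<lbrakk>z \<in> space cube; v \<in> V\<rbrakk> \<Longrightarrow> F (\<lambda>u\<in>V. z (\<pi> u)) v = F z (\<pi> v)"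
  shows "joint_entropy (relabel \<pi> ` B) = joint_entropy B"
proof -
  define s where "s \<omega> = (\<lambda>u\<in>V. Z (\<pi> u) \<omega>)" for \<omega>
  have \<pi>V: "\<pi> u \<in> V" if "u \<in> V" for u using \<pi> that by (auto simp: bij_betw_def)
  have s: "s \<in> M \<rightarrow>\<^sub>M cube"
    unfolding s_def[abs_def] by (intro measurable_restrict Z_measurable \<pi>V)
  have s_eq: "s \<omega> = (\<lambda>u\<in>V. sample \<omega> (\<pi> u))" for \<omega>
    using \<pi>V by (auto simp: s_def sample_def)
  have shift: "observed (relabel \<pi> j) \<omega> = reading j (s \<omega>)" if "\<omega> \<in> space M" "j \<in> indices" for \<omega> j
    using that equivariant[OF measurable_space[OF sample_measurable that(1)]]
    by (auto simp: observed_def reading_def relabel_def s_eq)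
  let ?h = "\<lambda>z. \<lambda>j\<in>B. reading j z"
  have h: "simple_function M (\<lambda>\<omega>. ?h (t \<omega>))" if t: "t \<in> M \<rightarrow>\<^sub>M cube" for t
  proof -
    interpret T: label_family M "\<lambda>j \<omega>. reading j (t \<omega>)" indices
      by unfold_locales (simp add: simple_function_reading t)
    show ?thesis using T.simple_joint_label[OF B] by (simp add: joint_label_def[abs_def])
  qed
  have "relabel \<pi> j \<in> indices" if "j \<in> indices" for j
    using that \<pi>V by (cases j) (auto simp: relabel_def)
  then have rB: "finite (relabel \<pi> ` B)" "relabel \<pi> ` B \<subseteq> indices"
    using B by auto
  have agree: "?h (s \<omega>) = ?h (s \<omega>') \<longleftrightarrow> joint_label observed (relabel \<pi> ` B) \<omega> = joint_label observed (relabel \<pi> ` B) \<omega>'"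
    if "\<omega> \<in> space M" "\<omega>' \<in> space M" for \<omega> \<omega>'
  proof -
    have "?h (s \<omega>) = ?h (s \<omega>') \<longleftrightarrow> (\<forall>j\<in>B. reading j (s \<omega>) = reading j (s \<omega>'))"
      by (auto simp: restrict_def fun_eq_iff)
    also have "\<dots> \<longleftrightarrow> (\<forall>j\<in>B. observed (relabel \<pi> j) \<omega> = observed (relabel \<pi> j) \<omega>')"
      using that B(2) by (intro ball_cong refl) (simp add: shift subset_iff)
    finally show ?thesis by (auto simp: joint_label_eq_iff)
  qed
  have "joint_entropy (relabel \<pi> ` B) = shannon_entropy M (\<lambda>\<omega>. ?h (s \<omega>))"
    unfolding joint_entropy_def using agree
    by (intro antisym entropy_mono_determined simple_joint_label rB h s) auto
  also have "\<dots> = shannon_entropy M (\<lambda>\<omega>. ?h (sample \<omega>))"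
  proof (rule entropy_same_law[OF s sample_measurable])
    show "simple_function M (\<lambda>\<omega>. ?h (s \<omega>))" "simple_function M (\<lambda>\<omega>. ?h (sample \<omega>))"
      by (rule h s sample_measurable)+
    show "distr M cube s = distr M cube sample"
      using distr_sample[OF iid V_nonempty \<pi>] distr_sample[OF iid V_nonempty bij_betw_id]
      by (simp add: s_def[abs_def] sample_def[abs_def])
    show "{z \<in> space cube. ?h z = y} \<in> sets cube" for y
    proof (cases "y \<in> extensional B")
      case True
      then have "{z \<in> space cube. ?h z = y} = {z \<in> space cube. \<forall>j\<in>B. reading j z = y j}"
        by (auto simp: extensional_def restrict_def fun_eq_iff)
      also have "\<dots> \<in> sets cube"
        using B reading_measurable
        by (intro sets.sets_Collect_finite_All Collect_eq_sets) auto
      finally show ?thesis .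
    next
      case False
      then have "{z \<in> space cube. ?h z = y} = {}" by auto
      then show ?thesis by (simp only: sets.empty_sets)
    qed
  qed
  also have "\<dots> = joint_entropy B"
    unfolding joint_entropy_def by (simp add: joint_label_def[abs_def] observed_def)
  finally show ?thesis .
qed

text \<open>
  If the observations in \<open>C\<close> almost surely depend only on the variables other than \<open>Z\<^sub>u\<close>, they are
  independent of \<open>Z\<^sub>u\<close>. Independence passes to the observations themselves because it only concerns
  probabilities of events, which are insensitive to null sets.
\<close>

lemma shared_information_absent:
  assumes u: "u \<in> V" and C: "finite C" "C \<subseteq> indices"
    and h: "\<And>j. j \<in> C \<Longrightarrow> h j \<in> PiM (V - {u}) (\<lambda>_. unit_lborel) \<rightarrow>\<^sub>M count_space UNIV"
    and C_eq: "\<And>j. j \<in> C \<Longrightarrow> AE \<omega> in M. observed j \<omega> = h j (\<lambda>w\<in>V - {u}. Z w \<omega>)"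
  shows "shared_information (block {u} k) C = 0"
proof (rule shared_information_indep)
  fix b c
  let ?P = "PiM {u} (\<lambda>_. unit_lborel)" and ?Q = "PiM (V - {u}) (\<lambda>_. unit_lborel)"
  let ?zu = "\<lambda>\<omega>. \<lambda>w\<in>{u}. Z w \<omega>" and ?zr = "\<lambda>\<omega>. \<lambda>w\<in>V - {u}. Z w \<omega>"
  define E where "E = {z \<in> space ?P. \<forall>j\<in>block {u} k. reading j z = b j}"
  define E' where "E' = {z \<in> space ?Q. \<forall>j\<in>C. h j z = c j}"
  have ind: "indep_var ?P ?zu ?Q ?zr"
    using iid u by (intro indep_var_restrict) (auto simp: iid_process_def)
  note rv = indep_var_rv1[OF ind] indep_var_rv2[OF ind]
  have E: "E \<in> sets ?P"
    unfolding E_def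
  proof (intro sets.sets_Collect_finite_All block_finite)
    fix j assume "j \<in> block {u} k"
    then obtain i where j: "j = Inr (u, i)" by (auto simp: block_def)
    then show "{z \<in> space ?P. reading j z = b j} \<in> sets ?P" by (simp add: Collect_eq_sets bit_measurable)
  qed simp
  have E': "E' \<in> sets ?Q"
    unfolding E'_def using C(1) h by (intro sets.sets_Collect_finite_All Collect_eq_sets) auto
  have AEC: "AE \<omega> in M. \<forall>j\<in>C. observed j \<omega> = h j (?zr \<omega>)"
    using C(1) C_eq by (intro AE_finite_allI)
  have b_iff: "(\<forall>j\<in>block {u} k. observed j \<omega> = b j) \<longleftrightarrow> ?zu \<omega> \<in> E" if "\<omega> \<in> space M" for \<omega>
    using that u measurable_space[OF rv(1) that]
    by (auto simp: E_def block_def observed_def reading_def sample_def)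
  have meas: "{\<omega> \<in> space M. \<forall>j\<in>D. observed j \<omega> = d j} \<in> events" if "finite D" "D \<subseteq> indices" for D d
  proof (intro sets.sets_Collect_finite_All)
    fix j assume "j \<in> D"
    then show "{\<omega> \<in> space M. observed j \<omega> = d j} \<in> events"
      using simple_functionD(2)[OF simple_label, of j "{d j}"] that
      by (auto simp: vimage_def Int_def conj_commute)
  qed (use that in auto)
  have B: "finite (block {u} k)" "block {u} k \<subseteq> indices"
    using u by (auto intro: block_finite simp: block_def)
  have evu: "?zu -` E \<inter> space M \<in> events" and evr: "?zr -` E' \<inter> space M \<in> events"
    using measurable_sets[OF rv(1) E] measurable_sets[OF rv(2) E'] by auto
  have "prob {\<omega>\<in>space M. (\<forall>j\<in>block {u} k. observed j \<omega> = b j) \<and> (\<forall>j\<in>C. observed j \<omega> = c j)}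
      = prob ((\<lambda>\<omega>. (?zu \<omega>, ?zr \<omega>)) -` (E \<times> E') \<inter> space M)"
  proof (rule finite_measure_eq_AE)
    show "AE \<omega> in M. (\<omega> \<in> {\<omega>\<in>space M. (\<forall>j\<in>block {u} k. observed j \<omega> = b j) \<and> (\<forall>j\<in>C. observed j \<omega> = c j)})
        \<longleftrightarrow> \<omega> \<in> (\<lambda>\<omega>. (?zu \<omega>, ?zr \<omega>)) -` (E \<times> E') \<inter> space M"
      using AEC AE_space
    proof eventually_elim
      case (elim \<omega>)
      then show ?case using b_iff[of \<omega>] measurable_space[OF rv(2), of \<omega>] by (auto simp: E'_def)
    qed
    show "{\<omega>\<in>space M. (\<forall>j\<in>block {u} k. observed j \<omega> = b j) \<and> (\<forall>j\<in>C. observed j \<omega> = c j)} \<in> events"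
      using sets.Int[OF meas[OF B, of b] meas[OF C, of c]] by (simp add: Int_def conj_ac) 
    have "(\<lambda>\<omega>. (?zu \<omega>, ?zr \<omega>)) -` (E \<times> E') \<inter> space M = (?zu -` E \<inter> space M) \<inter> (?zr -` E' \<inter> space M)" by auto
    then show "(\<lambda>\<omega>. (?zu \<omega>, ?zr \<omega>)) -` (E \<times> E') \<inter> space M \<in> events" using evu evr by auto
  qed
  also have "\<dots> = prob (?zu -` E \<inter> space M) * prob (?zr -` E' \<inter> space M)"
    by (rule indep_varD[OF ind E E'])
  also have "prob (?zu -` E \<inter> space M) = prob {\<omega>\<in>space M. \<forall>j\<in>block {u} k. observed j \<omega> = b j}"
    using b_iff by (intro arg_cong[of _ _ prob]) auto
  also have "prob (?zr -` E' \<inter> space M) = prob {\<omega>\<in>space M. \<forall>j\<in>C. observed j \<omega> = c j}"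
  proof (rule finite_measure_eq_AE)
    show "AE \<omega> in M. (\<omega> \<in> ?zr -` E' \<inter> space M) \<longleftrightarrow> \<omega> \<in> {\<omega>\<in>space M. \<forall>j\<in>C. observed j \<omega> = c j}"
      using AEC AE_space
    proof eventually_elim
      case (elim \<omega>)
      then show ?case using measurable_space[OF rv(2), of \<omega>] by (auto simp: E'_def)
    qed
  qed (use evr meas[OF C] in auto)
  finally show "prob {\<omega>\<in>space M. (\<forall>j\<in>block {u} k. observed j \<omega> = b j) \<and> (\<forall>j\<in>C. observed j \<omega> = c j)}
     = prob {\<omega>\<in>space M. \<forall>j\<in>block {u} k. observed j \<omega> = b j} * prob {\<omega>\<in>space M. \<forall>j\<in>C. observed j \<omega> = c j}" .
qed (use u C in \<open>auto intro: block_finite simp: block_def\<close>)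

section \<open>Finite observations determine the labels\<close>

text \<open>An exhaustion of \<open>V\<close> by finite sets, taken from an enumeration.\<close>

definition initial :: "nat \<Rightarrow> 'v set" where
  "initial k = {v\<in>V. to_nat_on V v < k}"

definition bits :: "nat \<Rightarrow> ('v + 'v \<times> nat) set" where
  "bits k = block (initial k) k"

lemma initial_finite: "finite (initial k)"
proof -
  have "inj_on (to_nat_on V) (initial k)"
    using inj_on_to_nat_on[OF countable_V] by (rule inj_on_subset) (auto simp: initial_def)
  moreover have "to_nat_on V ` initial k \<subseteq> {..<k}" by (auto simp: initial_def)
  ultimately show ?thesis by (meson finite_imageD finite_lessThan finite_subset)
qed

lemma initial_subset: "initial k \<subseteq> V"
  by (auto simp: initial_def)

lemma initial_mono: "k \<le> m \<Longrightarrow> initial k \<subseteq> initial m"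
  by (auto simp: initial_def)

lemma initial_exhausts:
  assumes "finite N" "N \<subseteq> V"
  obtains m where "k \<le> m" "N \<subseteq> initial m"
proof
  let ?m = "Suc (Max (insert k (to_nat_on V ` N)))"
  show "k \<le> ?m" using assms by (simp add: le_SucI)
  show "N \<subseteq> initial ?m"
    using assms by (auto simp: initial_def less_Suc_eq_le)
qed

lemma bits_finite: "finite (bits k)"
  unfolding bits_def by (intro block_finite initial_finite)

lemma bits_indices: "bits k \<subseteq> indices"
  unfolding bits_def by (intro block_indices initial_subset)

lemma bits_mono: "k \<le> m \<Longrightarrow> bits k \<subseteq> bits m"
  unfolding bits_def by (intro block_mono initial_mono)

text \<open>The event that guessing \<open>E\<close> from the bits of level \<open>k\<close>, by the decision rule \<open>C\<close>, goes wrong.\<close>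

definition miss :: "'w set \<Rightarrow> nat \<Rightarrow> ('v + 'v \<times> nat \<Rightarrow> 's + bool) set \<Rightarrow> 'w set" where
  "miss E k C = {\<omega>\<in>space M. (\<omega> \<in> E) \<noteq> (joint_label observed (bits k) \<omega> \<in> C)}"

definition approximable :: "'w set set" where
  "approximable = {E\<in>events. \<forall>e>0. \<exists>k C. prob (miss E k C) < e}"

lemma joint_label_bits_event: "{\<omega>\<in>space M. joint_label observed (bits k) \<omega> \<in> C} \<in> events"
  using simple_functionD(2)[OF simple_joint_label[OF bits_finite bits_indices], of k C]
  by (simp add: vimage_def Int_def conj_commute)

lemma miss_event:
  assumes "E \<in> events"
  shows "miss E k C \<in> events"
proof -
  let ?A = "{\<omega>\<in>space M. joint_label observed (bits k) \<omega> \<in> C}"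
  have "miss E k C = (E - ?A) \<union> (?A - E)"
    using sets.sets_into_space[OF assms] by (auto simp: miss_def)
  then show ?thesis using assms joint_label_bits_event[of k C] by auto
qed

lemma miss_refine:
  assumes "k \<le> m"
  shows "\<exists>C'. miss E m C' = miss E k C"
proof
  have "restrict (joint_label observed (bits m) \<omega>) (bits k) = joint_label observed (bits k) \<omega>" for \<omega>
    using bits_mono[OF assms] by (auto simp: joint_label_def restrict_def fun_eq_iff)
  then show "miss E m {f. restrict f (bits k) \<in> C} = miss E k C"
    by (simp add: miss_def)
qed

lemma approximable_Un:
  assumes "A \<in> approximable" "B \<in> approximable"
  shows "A \<union> B \<in> approximable"
  unfolding approximable_def
proof safe
  have ev: "A \<in> events" "B \<in> events" using assms by (auto simp: approximable_def)
  then show "A \<union> B \<in> events" by auto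
  fix e :: real assume "0 < e"
  then have "0 < e / 2" by simp
  then obtain k C k' C' where *: "prob (miss A k C) < e / 2" "prob (miss B k' C') < e / 2"
    using assms unfolding approximable_def by blast
  define m where "m = max k k'"
  have m: "k \<le> m" "k' \<le> m" by (auto simp: m_def)
  obtain D where D: "miss A m D = miss A k C" using miss_refine[OF m(1)] by blast
  obtain D' where D': "miss B m D' = miss B k' C'" using miss_refine[OF m(2)] by blast
  have "prob (miss (A \<union> B) m (D \<union> D')) \<le> prob (miss A m D \<union> miss B m D')"
    using ev by (intro finite_measure_mono sets.Un miss_event) (auto simp: miss_def)
  also have "\<dots> \<le> prob (miss A m D) + prob (miss B m D')"
    using ev by (intro measure_Un_le miss_event)
  also have "\<dots> < e" using * D D' by simp
  finally show "\<exists>k C. prob (miss (A \<union> B) k C) < e" by blast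
qed

text \<open>
  A countable union is approximated by a finite one, up to small probability, and finite unions are
  handled by \<open>approximable_Un\<close>.
\<close>

lemma approximable_sigma_algebra: "sigma_algebra (space M) approximable"
proof -
  have empty: "{} \<in> approximable"
    unfolding approximable_def by (auto simp: miss_def intro!: exI[of _ "{}"])
  have compl: "space M - A \<in> approximable" if "A \<in> approximable" for A
  proof -
    have "miss (space M - A) k (- C) = miss A k C" for k C by (auto simp: miss_def)
    then show ?thesis using that unfolding approximable_def by auto metis
  qed
  have UN: "(\<Union>n. A n) \<in> approximable" if A: "range A \<subseteq> approximable" for A :: "nat \<Rightarrow> 'w set"
    unfolding approximable_def
  proof safe
    define B where "B n = (\<Union>i<n. A i)" for n
    have ev: "A n \<in> events" for n using A by (auto simp: approximable_def)
    then show U: "(\<Union>n. A n) \<in> events" by auto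
    have B: "B n \<in> approximable" for n
    proof (induction n)
      case (Suc n)
      have "B (Suc n) = B n \<union> A n" by (auto simp: B_def less_Suc_eq)
      then show ?case using Suc A approximable_Un by auto
    qed (simp add: B_def empty)
    then have Bev: "B n \<in> events" for n by (auto simp: approximable_def)
    fix e :: real assume e: "0 < e"
    have "(\<lambda>n. prob (B n)) \<longlonglongrightarrow> prob (\<Union>n. B n)"
    proof (rule finite_Lim_measure_incseq)
      show "incseq B" unfolding incseq_def B_def by (intro allI impI UN_mono) auto
    qed (use Bev in auto)
    moreover have "(\<Union>n. B n) = (\<Union>n. A n)" by (auto simp: B_def)
    ultimately have "\<forall>\<^sub>F n in sequentially. prob (\<Union>n. A n) - e / 2 < prob (B n)"
      using e by (intro order_tendstoD(1)) auto
    then obtain n where n: "prob (\<Union>n. A n) - e / 2 < prob (B n)"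
      by (auto simp: eventually_sequentially)
    have "0 < e / 2" using e by simp
    then obtain k C where kC: "prob (miss (B n) k C) < e / 2"
      using B[of n] unfolding approximable_def by blast
    have sub: "B n \<subseteq> (\<Union>n. A n)" by (auto simp: B_def)
    have "prob (miss (\<Union>n. A n) k C) \<le> prob (((\<Union>n. A n) - B n) \<union> miss (B n) k C)"
      using U Bev[of n] sub by (intro finite_measure_mono sets.Un sets.Diff miss_event) (auto simp: miss_def)
    also have "\<dots> \<le> prob ((\<Union>n. A n) - B n) + prob (miss (B n) k C)"
      using U Bev[of n] by (intro measure_Un_le sets.Diff miss_event)
    also have "prob ((\<Union>n. A n) - B n) = prob (\<Union>n. A n) - prob (B n)"
      using U Bev[of n] sub by (rule finite_measure_Diff)
    finally have "prob (miss (\<Union>n. A n) k C) < e" using n kC by simp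
    then show "\<exists>k C. prob (miss (\<Union>n. A n) k C) < e" by blast
  qed
  have "approximable \<subseteq> Pow (space M)"
    using sets.sets_into_space by (auto simp: approximable_def)
  then show ?thesis
    using empty compl UN by (auto simp: sigma_algebra_iff2)
qed

text \<open>
  Each bit is approximated without error, and comparisons with rational numbers generate the Borel sets. Hence
  all \<open>Z\<^sub>u\<close> are measurable for the \<open>\<sigma>\<close>-algebra of approximable events, and so is every label that is a
  measurable function of them.
\<close>

lemma label_event_approximable:
  assumes v: "v \<in> V"
  shows "{\<omega>\<in>space M. F (sample \<omega>) v = x} \<in> approximable"
proof -
  interpret A: sigma_algebra "space M" approximable by (rule approximable_sigma_algebra)
  define N where "N = sigma (space M) approximable"
  have N: "space N = space M" "sets N = approximable"
    by (simp_all add: N_def A.space_measure_of_eq A.sets_measure_of_eq)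
  have bit: "{\<omega>\<in>space M. Z u \<omega> < threshold i} \<in> approximable" if u: "u \<in> V" for u i
  proof -
    obtain k where k: "Suc i \<le> k" "u \<in> initial k" using initial_exhausts[of "{u}" "Suc i"] u by auto
    have "Inr (u, i) \<in> bits k" using k by (auto simp: bits_def block_def)
    then have "joint_label observed (bits k) \<omega> (Inr (u, i)) = Inr (Z u \<omega> < threshold i)" for \<omega>
      using u by (simp add: joint_label_def observed_def reading_def sample_def)
    then have "miss {\<omega>\<in>space M. Z u \<omega> < threshold i} k {f. f (Inr (u, i)) = Inr True} = {}"
      by (auto simp: miss_def)
    moreover have "{\<omega>\<in>space M. Z u \<omega> < threshold i} \<in> events"
      using measurable_sets[OF Z_measurable[OF u] below_threshold_measurable[of "threshold i"]]
        measurable_space[OF Z_measurable[OF u]]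
      by (auto simp: vimage_def Int_def conj_commute cong: conj_cong)
    ultimately show ?thesis by (auto simp: approximable_def intro!: exI[of _ k] exI[of _ "{f. f (Inr (u, i)) = Inr True}"])
  qed
  have "Z u \<in> N \<rightarrow>\<^sub>M unit_lborel" if u: "u \<in> V" for u
    unfolding unit_lborel_def
  proof (rule measurable_restrict_space2)
    show "Z u \<in> space N \<rightarrow> {0..1}"
      using measurable_space[OF Z_measurable[OF u]] by (auto simp: N unit_lborel_def space_restrict_space)
    have "Z u \<in> borel_measurable N"
    proof (rule borel_measurableI_less)
      fix y
      have "{\<omega>\<in>space N. Z u \<omega> < y} = (\<Union>i\<in>{i. threshold i \<le> y}. {\<omega>\<in>space M. Z u \<omega> < threshold i})"
      proof safe
        fix \<omega> assume \<omega>: "\<omega> \<in> space N" "Z u \<omega> < y"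
        then obtain q where q: "q \<in> \<rat>" "Z u \<omega> < q" "q < y" using Rats_dense_in_real by blast
        then obtain i where "threshold i = q"
          unfolding threshold_def using from_nat_into_surj[OF countable_rat] by blast
        then show "\<omega> \<in> (\<Union>i\<in>{i. threshold i \<le> y}. {\<omega>\<in>space M. Z u \<omega> < threshold i})"
          using \<omega> q by (auto simp: N intro!: exI[of _ i])
      qed (auto simp: N)
      also have "\<dots> \<in> sets N"
        using bit[OF u] by (auto simp: N intro!: A.countable_UN'')
      finally show "{\<omega>\<in>space N. Z u \<omega> < y} \<in> sets N" .
    qed
    then show "Z u \<in> N \<rightarrow>\<^sub>M lborel" by simp
  qed
  then have "sample \<in> N \<rightarrow>\<^sub>M cube"
    unfolding sample_def[abs_def] by (intro measurable_restrict)
  from measurable_compose[OF this reading_measurable[of "Inl v"]] v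
  have "(\<lambda>\<omega>. reading (Inl v) (sample \<omega>)) \<in> N \<rightarrow>\<^sub>M count_space UNIV" by auto
  from Collect_eq_sets[OF this, of "Inl x"] show ?thesis by (simp add: N reading_def)
qed

text \<open>
  Let \<open>D\<^sub>x\<close> say whether the guess of the event \<open>X\<^sub>v = x\<close> from the bits is wrong. The bits together with all
  the \<open>D\<^sub>x\<close> determine \<open>X\<^sub>v\<close>, so the conditional entropy of \<open>X\<^sub>v\<close> given the bits is at most the sum of the
  entropies of the \<open>D\<^sub>x\<close>, and each of these is small because \<open>D\<^sub>x\<close> has small probability.
\<close>

lemma conditional_entropy_vanishes:
  assumes v: "v \<in> V" and e: "0 < e"
  obtains k where "joint_entropy (insert (Inl v) (bits k)) \<le> joint_entropy (bits k) + e"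
proof -
  let ?X = "\<lambda>\<omega>. F (sample \<omega>) v"
  \<comment> \<open>With this \<open>d\<close> the sum of the bounds \<open>3 \<surd>d\<close> over all states stays below \<open>e\<close>.\<close>
  define d where "d = (e / (3 * (real (card S) + 1)))\<^sup>2"
  have d: "0 < d" using e by (simp add: d_def)
  have "\<forall>x. \<exists>k C. prob (miss {\<omega>\<in>space M. ?X \<omega> = x} k C) < d"
    using label_event_approximable[OF v] d by (simp add: approximable_def)
  then obtain kk CC where kC: "\<forall>x. prob (miss {\<omega>\<in>space M. ?X \<omega> = x} (kk x) (CC x)) < d"
    unfolding choice_iff by blast
  define k where "k = Max (insert 0 (kk ` S))"
  have "\<forall>x\<in>S. \<exists>C. miss {\<omega>\<in>space M. ?X \<omega> = x} k C = miss {\<omega>\<in>space M. ?X \<omega> = x} (kk x) (CC x)"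
    using finite_S by (intro ballI miss_refine) (simp add: k_def)
  from bchoice[OF this] obtain C
    where C: "\<forall>x\<in>S. miss {\<omega>\<in>space M. ?X \<omega> = x} k (C x) = miss {\<omega>\<in>space M. ?X \<omega> = x} (kk x) (CC x)"
    by (elim exE)
  define D where "D x \<omega> = ((?X \<omega> = x) \<noteq> (joint_label observed (bits k) \<omega> \<in> C x))" for x \<omega>
  have D_miss: "{\<omega>\<in>space M. D x \<omega>} = miss {\<omega>\<in>space M. ?X \<omega> = x} k (C x)" for x
    by (auto simp: D_def miss_def)
  have D: "simple_function M (D x)" for x
  proof -
    have "simple_function M (observed (Inl v))" using v by (intro simple_label) auto
    then have "simple_function M ((\<lambda>p. (fst p = Inl x) \<noteq> (snd p \<in> C x)) \<circ> (\<lambda>\<omega>. (observed (Inl v) \<omega>, joint_label observed (bits k) \<omega>)))"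
      by (intro simple_function_compose simple_function_Pair simple_joint_label bits_finite bits_indices)
    then show ?thesis by (simp add: comp_def D_def[abs_def] observed_def reading_def)
  qed
  interpret D: label_family M D S by unfold_locales (rule D)
  have "joint_entropy (insert (Inl v) (bits k))
      \<le> shannon_entropy M (\<lambda>\<omega>. (joint_label D S \<omega>, joint_label observed (bits k) \<omega>))"
    unfolding joint_entropy_def
  proof (rule entropy_mono_determined)
    fix \<omega> \<omega>' assume \<omega>: "\<omega> \<in> space M" "\<omega>' \<in> space M"
      and eq: "(joint_label D S \<omega>, joint_label observed (bits k) \<omega>) = (joint_label D S \<omega>', joint_label observed (bits k) \<omega>')"
    have "?X \<omega> \<in> S" using F_in_S[OF measurable_space[OF sample_measurable \<omega>(1)] v] .
    then have "D (?X \<omega>) \<omega> = D (?X \<omega>) \<omega>'" using eq by (simp add: D.joint_label_eq_iff)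
    then have "?X \<omega>' = ?X \<omega>" using eq by (auto simp: D_def)
    then show "joint_label observed (insert (Inl v) (bits k)) \<omega> = joint_label observed (insert (Inl v) (bits k)) \<omega>'"
      using eq by (simp add: joint_label_eq_iff) (simp add: observed_def reading_def)
  qed (intro simple_function_Pair simple_joint_label bits_finite bits_indices D.simple_joint_label finite_S order_refl)
  also have "\<dots> \<le> D.joint_entropy S + joint_entropy (bits k)"
    unfolding joint_entropy_def D.joint_entropy_def
    by (intro entropy_Pair_le simple_joint_label bits_finite bits_indices D.simple_joint_label finite_S order_refl)
  also have "D.joint_entropy S \<le> (\<Sum>x\<in>S. shannon_entropy M (D x))"
    using finite_S by (intro D.joint_entropy_le_sum) auto
  also have "\<dots> \<le> (\<Sum>x\<in>S. 3 * sqrt d)"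
  proof (rule sum_mono)
    fix x assume x: "x \<in> S"
    have "prob {\<omega>\<in>space M. D x \<omega>} \<le> d" using spec[OF kC, of x] bspec[OF C x] by (simp add: D_miss)
    then show "shannon_entropy M (D x) \<le> 3 * sqrt d"
      using binary_entropy_le[OF D[of x]] by (smt (verit) real_sqrt_le_mono)
  qed
  also have "\<dots> \<le> e"
  proof -
    have "sqrt d = e / (3 * (real (card S) + 1))" using e by (simp add: d_def)
    then have "sqrt d * (3 * (real (card S) + 1)) = e" by simp
    moreover have "0 \<le> sqrt d" using d by simp
    moreover have "(\<Sum>x\<in>S. 3 * sqrt d) = sqrt d * (3 * (real (card S) + 1)) - 3 * sqrt d"
      by (simp add: algebra_simps)
    ultimately show ?thesis by linarith
  qed
  finally show ?thesis using that by (simp add: add.commute)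
qed

section \<open>Splitting the entropy of the labels among the vertices\<close>

text \<open>
  At bit level \<open>k\<close>, this is \<open>I(Z\<^sub>u ; X\<^sub>U, Z\<^sub>A)\<close>. For \<open>u \<notin> A\<close> it equals the decrement
  \<open>I(X\<^sub>U ; Z\<^sub>u | Z\<^sub>A)\<close> by independence, and in this form its monotonicity in \<open>U\<close>, \<open>A\<close> and \<open>k\<close> is evident.
\<close>

definition gain :: "nat \<Rightarrow> 'v set \<Rightarrow> 'v \<Rightarrow> 'v set \<Rightarrow> real" where
  "gain k U u A = shared_information (block {u} k) (Inl ` U \<union> block A k)"

text \<open>The Shapley value of \<open>u\<close> in the game of the players \<open>N\<close> with value function \<open>A \<mapsto> I(X\<^sub>U ; Z\<^sub>A)\<close>.\<close>

definition share :: "'v set \<Rightarrow> nat \<Rightarrow> 'v set \<Rightarrow> 'v \<Rightarrow> real" where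
  "share N k U u = (if u \<in> N then shapley_average (N - {u}) (gain k U u) else 0)"

definition full_share :: "'v set \<Rightarrow> 'v \<Rightarrow> ennreal" where
  "full_share U u = (SUP k. ennreal (share (initial k) k U u))"

lemma labels_block_finite: "finite U \<Longrightarrow> finite A \<Longrightarrow> finite (Inl ` U \<union> block A k)"
  by (simp add: block_finite)

lemma labels_block_indices: "U \<subseteq> V \<Longrightarrow> A \<subseteq> V \<Longrightarrow> Inl ` U \<union> block A k \<subseteq> indices"
  by (auto simp: block_def)

lemma gain_mono:
  assumes "u \<in> V" "finite U'" "U' \<subseteq> V" "finite A'" "A' \<subseteq> V" "U \<subseteq> U'" "A \<subseteq> A'" "k \<le> m"
  shows "gain k U u A \<le> gain m U' u A'"
  unfolding gain_def using assms
  by (intro shared_information_mono labels_block_finite labels_block_indices block_finite block_indices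
      block_mono Un_mono image_mono) auto

lemma gain_nonneg:
  assumes "u \<in> V" "finite U" "U \<subseteq> V" "finite A" "A \<subseteq> V"
  shows "0 \<le> gain k U u A"
  unfolding gain_def using assms
  by (intro shared_information_nonneg labels_block_finite labels_block_indices block_finite block_indices) auto

lemma share_nonneg:
  assumes "finite N" "N \<subseteq> V" "finite U" "U \<subseteq> V"
  shows "0 \<le> share N k U u"
proof (cases "u \<in> N")
  case True
  have "0 = shapley_average (N - {u}) (\<lambda>_. 0)" by (simp add: shapley_average_zero)
  also have "\<dots> \<le> shapley_average (N - {u}) (gain k U u)"
    using assms True by (intro shapley_average_mono gain_nonneg) (auto intro: finite_subset)
  finally show ?thesis using True by (simp add: share_def)
qed (simp add: share_def)

lemma share_mono:
  assumes "finite N'" "N' \<subseteq> V" "finite U'" "U' \<subseteq> V" "N \<subseteq> N'" "U \<subseteq> U'" "k \<le> m"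
  shows "share N k U u \<le> share N' m U' u"
proof (cases "u \<in> N")
  case True
  then have u: "u \<in> V" "u \<in> N'" using assms by auto
  have fin: "finite A" "A \<subseteq> V" if "A \<subseteq> N'" for A using that assms finite_subset by auto
  have "shapley_average (N - {u}) (gain k U u) \<le> shapley_average (N' - {u}) (gain k U u)"
  proof (intro shapley_average_mono_set)
    fix A w assume A: "A \<subseteq> N' - {u}" "w \<in> N' - {u}"
    have "finite U" "U \<subseteq> V" using assms finite_subset by auto
    then show "gain k U u A \<le> gain k U u (insert w A)"
      using A u fin[of "insert w A"] by (intro gain_mono) auto
  qed (use assms in auto)
  also have "\<dots> \<le> shapley_average (N' - {u}) (gain m U' u)"
  proof (rule shapley_average_mono)
    fix A assume "A \<subseteq> N' - {u}"
    then have "A \<subseteq> N'" by auto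
    then show "gain k U u A \<le> gain m U' u A" using assms u fin by (intro gain_mono) auto
  qed
  finally show ?thesis using True u by (simp add: share_def)
next
  case False
  then show ?thesis using share_nonneg[OF assms(1-4)] by (simp add: share_def)
qed

lemma share_initial_incseq:
  assumes "finite U" "U \<subseteq> V"
  shows "incseq (\<lambda>k. ennreal (share (initial k) k U u))"
  using assms by (intro incseq_SucI ennreal_leI share_mono initial_finite initial_subset initial_mono) auto

lemma shared_information_blocks:
  assumes "u \<in> V" "finite A" "A \<subseteq> V - {u}"
  shows "shared_information (block {u} k) (block A k) = 0"
proof (rule shared_information_absent[where h=reading])
  fix j assume "j \<in> block A k"
  then obtain a i where j: "j = Inr (a, i)" "a \<in> A" by (auto simp: block_def)
  then show "reading j \<in> PiM (V - {u}) (\<lambda>_. unit_lborel) \<rightarrow>\<^sub>M count_space UNIV"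
    using assms by (auto intro: bit_measurable)
  show "AE \<omega> in M. observed j \<omega> = reading j (\<lambda>w\<in>V - {u}. Z w \<omega>)"
    using j assms by (auto simp: observed_def reading_def sample_def)
next
  show "finite (block A k)" "block A k \<subseteq> indices"
    using assms by (intro block_finite block_indices; auto)+
qed (rule assms(1))

text \<open>
  The chain rule of information in the form of Shapley efficiency. That the gains are increments of
  \<open>A \<mapsto> I(X\<^sub>U ; Z\<^sub>A)\<close> is where the independence of \<open>Z\<^sub>u\<close> and \<open>Z\<^sub>A\<close> enters.
\<close>

lemma sum_share:
  assumes N: "finite N" "N \<subseteq> V" and U: "finite U" "U \<subseteq> V"
  shows "(\<Sum>u\<in>N. share N k U u) = shared_information (Inl ` U) (block N k)"
proof -
  define f where "f A = shared_information (Inl ` U) (block A k)" for A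
  have "(\<Sum>u\<in>N. share N k U u) = (\<Sum>u\<in>N. shapley_average (N - {u}) (\<lambda>A. f (insert u A) - f A))"
  proof (rule sum.cong[OF refl])
    fix u assume u: "u \<in> N"
    have "gain k U u A = f (insert u A) - f A" if A: "A \<subseteq> N - {u}" for A
    proof -
      have "shared_information (block {u} k) (block A k) = 0"
        using u A N by (intro shared_information_blocks) (auto intro: finite_subset)
      moreover have "block (insert u A) k = block {u} k \<union> block A k"
        using block_Un[of "{u}" A k] by simp
      ultimately show ?thesis
        by (simp add: gain_def f_def shared_information_def Un_ac)
    qed
    then show "share N k U u = shapley_average (N - {u}) (\<lambda>A. f (insert u A) - f A)"
      using u by (simp add: share_def cong: shapley_average_cong)
  qed
  also have "\<dots> = f N - f {}" by (rule shapley_efficient[OF N(1)])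
  also have "f {} = 0" by (simp add: f_def block_def shared_information_def joint_entropy_empty)
  finally show ?thesis by (simp add: f_def)
qed

lemma sum_full_share:
  assumes U: "finite U" "U \<subseteq> V"
  shows "(\<integral>\<^sup>+u. full_share U u \<partial>count_space V) = (SUP k. ennreal (shared_information (Inl ` U) (bits k)))"
proof -
  have "(\<integral>\<^sup>+u. full_share U u \<partial>count_space V)
      = (SUP k. \<integral>\<^sup>+u. ennreal (share (initial k) k U u) \<partial>count_space V)"
    unfolding full_share_def using share_initial_incseq[OF U]
    by (intro nn_integral_monotone_convergence_SUP) (auto simp: incseq_def le_fun_def)
  also have "\<dots> = (SUP k. ennreal (shared_information (Inl ` U) (bits k)))"
  proof (rule SUP_cong[OF refl])
    fix k
    have "(\<integral>\<^sup>+u. ennreal (share (initial k) k U u) \<partial>count_space V) = (\<Sum>u\<in>initial k. ennreal (share (initial k) k U u))"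
      by (intro nn_integral_count_space' initial_finite initial_subset) (simp add: share_def)
    also have "\<dots> = ennreal (\<Sum>u\<in>initial k. share (initial k) k U u)"
      by (intro sum_ennreal share_nonneg initial_finite initial_subset U)
    finally show "(\<integral>\<^sup>+u. ennreal (share (initial k) k U u) \<partial>count_space V) = ennreal (shared_information (Inl ` U) (bits k))"
      by (simp add: sum_share[OF initial_finite initial_subset U] bits_def)
  qed
  finally show ?thesis .
qed

lemma sum_full_share_le:
  assumes U: "finite U" "U \<subseteq> V"
  shows "(\<integral>\<^sup>+u. full_share U u \<partial>count_space V) \<le> ennreal (joint_entropy (Inl ` U))"
  unfolding sum_full_share[OF U]
proof (intro SUP_least ennreal_leI)
  fix k
  have "joint_entropy (bits k) \<le> joint_entropy (Inl ` U \<union> bits k)"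
    using U bits_finite bits_indices by (intro joint_entropy_mono) auto
  then show "shared_information (Inl ` U) (bits k) \<le> joint_entropy (Inl ` U)"
    by (simp add: shared_information_def)
qed

lemma sum_full_share_singleton_ge:
  assumes v: "v \<in> V"
  shows "ennreal (joint_entropy {Inl v}) \<le> (\<integral>\<^sup>+u. full_share {v} u \<partial>count_space V)"
proof (rule ennreal_le_epsilon)
  fix e :: real assume e: "0 < e"
  obtain k where k: "joint_entropy (insert (Inl v) (bits k)) \<le> joint_entropy (bits k) + e"
    using conditional_entropy_vanishes[OF v e] .
  have nn: "0 \<le> shared_information (Inl ` {v}) (bits k)"
    using v bits_finite bits_indices by (intro shared_information_nonneg) auto
  have "ennreal (joint_entropy {Inl v}) \<le> ennreal (shared_information (Inl ` {v}) (bits k) + e)"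
    using k by (intro ennreal_leI) (simp add: shared_information_def)
  also have "\<dots> = ennreal (shared_information (Inl ` {v}) (bits k)) + ennreal e"
    using nn e by simp
  also have "\<dots> \<le> (\<integral>\<^sup>+u. full_share {v} u \<partial>count_space V) + ennreal e"
    using v by (subst sum_full_share) (auto intro!: add_right_mono SUP_upper)
  finally show "ennreal (joint_entropy {Inl v}) \<le> (\<integral>\<^sup>+u. full_share {v} u \<partial>count_space V) + ennreal e" .
qed

text \<open>
  The permutation \<open>\<pi>\<close> maps the finite game on \<open>initial k\<close> to an isomorphic game on its image. The image
  need not belong to the exhaustion, but it is contained in some later \<open>initial m\<close>, whose game gives a
  larger share. The reverse inequality follows by applying the lemma to the inverse permutation.
\<close>

lemma full_share_relabel_le:
  assumes \<pi>: "bij_betw \<pi> V V"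
    and equivariant: "\<And>z v. \<lbrakk>z \<in> space cube; v \<in> V\<rbrakk> \<Longrightarrow> F (\<lambda>u\<in>V. z (\<pi> u)) v = F z (\<pi> v)"
    and U: "finite U" "U \<subseteq> V" and u: "u \<in> V"
  shows "full_share U u \<le> full_share (\<pi> ` U) (\<pi> u)"
  unfolding full_share_def
proof (rule SUP_mono)
  fix k
  have inj: "inj_on \<pi> V" and \<pi>V: "\<pi> ` A \<subseteq> V" if "A \<subseteq> V" for A using \<pi> that by (auto simp: bij_betw_def)
  have inf: "shared_information (relabel \<pi> ` B) (relabel \<pi> ` C) = shared_information B C"
    if "finite B" "B \<subseteq> indices" "finite C" "C \<subseteq> indices" for B C
    using that by (simp add: shared_information_def joint_entropy_relabel[OF _ _ \<pi> equivariant] flip: image_Un)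
  have g: "gain k (\<pi> ` U) (\<pi> u) (\<pi> ` A) = gain k U u A" if "finite A" "A \<subseteq> V" for A
    using inf[of "block {u} k" "Inl ` U \<union> block A k"] that U u
    by (simp add: gain_def relabel_block relabel_Inl image_Un block_finite block_indices)
       (auto simp: block_def)
  let ?N = "initial k"
  have fin: "finite A" "A \<subseteq> V" if "A \<subseteq> ?N" for A
    using that initial_subset[of k] initial_finite[of k] finite_subset by auto
  have share: "share (\<pi> ` ?N) k (\<pi> ` U) (\<pi> u) = share ?N k U u"
  proof (cases "u \<in> ?N")
    case True
    have "\<pi> ` ?N - {\<pi> u} = \<pi> ` (?N - {u})"
      using inj[OF order_refl] True initial_subset[of k] by (auto simp: inj_on_def subset_iff)
    moreover have "shapley_average (\<pi> ` (?N - {u})) (gain k (\<pi> ` U) (\<pi> u)) = shapley_average (?N - {u}) (gain k U u)"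
      using inj[OF order_refl] initial_subset[of k] fin
      by (subst shapley_average_image) (auto intro!: shapley_average_cong g intro: inj_on_subset)
    ultimately show ?thesis using True by (simp add: share_def)
  next
    case False
    then have "\<pi> u \<notin> \<pi> ` ?N" using inj[OF order_refl] u initial_subset[of k] by (auto simp: inj_on_def)
    then show ?thesis using False by (simp add: share_def)
  qed
  obtain m where m: "k \<le> m" "\<pi> ` ?N \<subseteq> initial m"
    using initial_exhausts[of "\<pi> ` ?N" k] initial_finite \<pi>V[OF initial_subset] by blast
  have "share ?N k U u \<le> share (initial m) m (\<pi> ` U) (\<pi> u)"
    unfolding share[symmetric] using U \<pi>V m by (intro share_mono initial_finite initial_subset) auto
  then show "\<exists>m\<in>UNIV. ennreal (share ?N k U u) \<le> ennreal (share (initial m) m (\<pi> ` U) (\<pi> u))"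
    by (auto intro!: exI[of _ m] ennreal_leI)
qed

text \<open>
  If \<open>Z\<^sub>u\<close> does not influence \<open>X\<^sub>v\<close>, it is independent of \<open>X\<^sub>v\<close> jointly with all the other variables, so
  nothing is ever gained by revealing it.
\<close>

lemma full_share_zero:
  assumes v: "v \<in> V" and u: "u \<in> V" and K: "K \<subseteq> V - {u}"
    and g: "g \<in> PiM K (\<lambda>_. unit_lborel) \<rightarrow>\<^sub>M count_space S"
    and F_eq: "AE \<omega> in M. F (sample \<omega>) v = g (\<lambda>w\<in>K. Z w \<omega>)"
  shows "full_share {v} u = 0"
proof -
  have "gain k {v} u A = 0" if A: "A \<subseteq> initial k - {u}" for k A
    unfolding gain_def
  proof (rule shared_information_absent[OF u])
    have A': "finite A" "A \<subseteq> V - {u}" using A initial_finite initial_subset[of k] by (auto intro: finite_subset)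
    show "finite (Inl ` {v} \<union> block A k)" "Inl ` {v} \<union> block A k \<subseteq> indices"
      using A' v by (intro labels_block_finite labels_block_indices; auto)+
    define h where "h j z = (case j of Inl _ \<Rightarrow> Inl (g (restrict z K)) | Inr _ \<Rightarrow> reading j z)" for j z
    fix j assume j: "j \<in> Inl ` {v} \<union> block A k"
    have "(\<lambda>z. Inl (g (restrict z K))) \<in> PiM (V - {u}) (\<lambda>_. unit_lborel) \<rightarrow>\<^sub>M (count_space UNIV :: ('s + bool) measure)"
      using measurable_compose[OF measurable_restrict_subset[OF K] g]
      by (rule measurable_compose) simp
    with j A' show "h j \<in> PiM (V - {u}) (\<lambda>_. unit_lborel) \<rightarrow>\<^sub>M count_space UNIV"
      by (auto simp: h_def[abs_def] block_def intro!: bit_measurable)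
    show "AE \<omega> in M. observed j \<omega> = h j (\<lambda>w\<in>V - {u}. Z w \<omega>)"
    proof (cases "j = Inl v")
      case True
      have "restrict (\<lambda>w\<in>V - {u}. Z w \<omega>) K = (\<lambda>w\<in>K. Z w \<omega>)" for \<omega>
        using K by (auto simp: restrict_def fun_eq_iff)
      with F_eq True show ?thesis by (simp add: h_def observed_def reading_def)
    next
      case False
      then show ?thesis
        using j A' by (auto simp: h_def observed_def reading_def sample_def block_def)
    qed
  qed
  then have "share (initial k) k {v} u = 0" for k
    by (simp add: share_def shapley_average_zero)
  then show ?thesis by (simp add: full_share_def)
qed

text \<open>
  The inequality holds for the real shares of each finite game, where subtraction is available, and
  passes to the suprema.
\<close>

lemma full_share_domination:
  fixes \<alpha> :: "'v set \<Rightarrow> real"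
  assumes "finite \<U>" and W: "finite W" "W \<subseteq> V"
    and \<U>: "\<And>U. U \<in> \<U> \<Longrightarrow> finite U \<and> U \<subseteq> V \<and> 0 \<le> \<alpha> U"
    and \<beta>: "0 \<le> \<beta>" "\<And>A. \<lbrakk>A \<subseteq> W; A \<noteq> {}\<rbrakk> \<Longrightarrow> \<beta> * real (card A) \<le> (\<Sum>U | U \<in> \<U> \<and> U \<inter> A \<noteq> {}. \<alpha> U)"
  shows "ennreal \<beta> * (\<Sum>v\<in>W. full_share {v} u) \<le> (\<Sum>U\<in>\<U>. ennreal (\<alpha> U) * full_share U u)"
proof -
  have W1: "finite {v}" "{v} \<subseteq> V" if "v \<in> W" for v using that W by auto
  have "(\<Sum>v\<in>W. full_share {v} u) = (SUP k. \<Sum>v\<in>W. ennreal (share (initial k) k {v} u))"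
    unfolding full_share_def using share_initial_incseq W1 by (intro ennreal_SUP_sum[symmetric]) auto
  then have "ennreal \<beta> * (\<Sum>v\<in>W. full_share {v} u) = (SUP k. ennreal \<beta> * (\<Sum>v\<in>W. ennreal (share (initial k) k {v} u)))"
    by (simp add: SUP_mult_left_ennreal)
  also have "\<dots> \<le> (\<Sum>U\<in>\<U>. ennreal (\<alpha> U) * full_share U u)"
  proof (rule SUP_least)
    fix k
    let ?s = "\<lambda>U. share (initial k) k U u"
    have nn: "0 \<le> ?s U" if "finite U" "U \<subseteq> V" for U
      using that by (intro share_nonneg initial_finite initial_subset)
    have "\<beta> * (\<Sum>v\<in>W. ?s {v}) \<le> (\<Sum>U\<in>\<U>. \<alpha> U * ?s U)"
    proof (rule threshold_domination)
      show "?s {v} \<le> ?s U" if "U \<in> \<U>" "v \<in> U \<inter> W" for U v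
        using that \<U>[of U] by (intro share_mono initial_finite initial_subset) auto
    qed (use assms nn W1 in auto)
    then have "ennreal (\<beta> * (\<Sum>v\<in>W. ?s {v})) \<le> ennreal (\<Sum>U\<in>\<U>. \<alpha> U * ?s U)" by (rule ennreal_leI)
    moreover have "ennreal (\<beta> * (\<Sum>v\<in>W. ?s {v})) = ennreal \<beta> * (\<Sum>v\<in>W. ennreal (?s {v}))"
      using \<beta>(1) nn W1 by (simp add: ennreal_mult' sum_ennreal)
    moreover have "ennreal (\<Sum>U\<in>\<U>. \<alpha> U * ?s U) = (\<Sum>U\<in>\<U>. ennreal (\<alpha> U) * ennreal (?s U))"
      using nn \<U> by (subst sum_ennreal[symmetric]) (auto simp: ennreal_mult intro!: sum.cong)
    moreover have "(\<Sum>U\<in>\<U>. ennreal (\<alpha> U) * ennreal (?s U)) \<le> (\<Sum>U\<in>\<U>. ennreal (\<alpha> U) * full_share U u)"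
      unfolding full_share_def by (intro sum_mono mult_left_mono SUP_upper) auto
    ultimately show "ennreal \<beta> * (\<Sum>v\<in>W. ennreal (?s {v})) \<le> (\<Sum>U\<in>\<U>. ennreal (\<alpha> U) * full_share U u)"
      by simp
  qed
  finally show ?thesis .
qed

end

section \<open>Mass transport\<close>

lemma orbit_representative:
  assumes "group_action G V \<phi>" "set_pmf \<mu> \<subseteq> orbits G V \<phi>" "C \<in> set_pmf \<mu>"
  shows "(SOME v. v \<in> C) \<in> V"
proof -
  interpret group_action G V \<phi> by fact
  obtain x where x: "x \<in> V" "C = orbit G \<phi> x" using assms(2,3) by (auto simp: orbits_def)
  then have "x \<in> C" using orbit_refl by simp
  then have "(SOME v. v \<in> C) \<in> C" by (rule someI)
  then show ?thesis using x element_image by (auto simp: orbit_def)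
qed

lemma orbit_nn_expectation_mono:
  assumes "\<And>C. C \<in> set_pmf \<mu> \<Longrightarrow> g (SOME v. v \<in> C) \<le> h (SOME v. v \<in> C)"
  shows "orbit_nn_expectation \<mu> g \<le> orbit_nn_expectation \<mu> h"
  unfolding orbit_nn_expectation_def using assms by (intro sum_mono mult_left_mono) auto

lemma orbit_nn_expectation_cmult:
  "orbit_nn_expectation \<mu> (\<lambda>v. c * g v) = c * orbit_nn_expectation \<mu> g"
  unfolding orbit_nn_expectation_def by (simp add: sum_distrib_left mult_ac)

lemma orbit_nn_expectation_ennreal:
  assumes "\<And>C. C \<in> set_pmf \<mu> \<Longrightarrow> 0 \<le> g (SOME v. v \<in> C)"
  shows "orbit_nn_expectation \<mu> (\<lambda>v. ennreal (g v)) = ennreal (orbit_expectation \<mu> g)"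
  unfolding orbit_nn_expectation_def orbit_expectation_def using assms
  by (subst sum_ennreal[symmetric]) (auto simp: ennreal_mult intro!: sum.cong)

theorem theorem3p3:
  fixes G :: "('g, 'r) monoid_scheme"
    and V :: "'v set"
    and \<phi> :: "'g \<Rightarrow> 'v \<Rightarrow> 'v"
    and \<mu> :: "'v set pmf"
    and \<alpha> :: "'v set \<Rightarrow> real"
    and M :: "'w measure"
    and Z :: "'v \<Rightarrow> 'w \<Rightarrow> real"
    and S :: "'s set"
    and X :: "'v \<Rightarrow> 'w \<Rightarrow> 's"
    and W :: "'v \<Rightarrow> 'v set"
  assumes "countable V"
    and "group_action G V \<phi>"
    and "finite (orbits G V \<phi>)"
    and "set_pmf \<mu> \<subseteq> orbits G V \<phi>"
    and "mass_transport_principle G V \<phi> \<mu>"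
    and "\<And>U. U \<subseteq> V \<Longrightarrow> 0 \<le> \<alpha> U"
    and "\<And>U \<gamma>. U \<subseteq> V \<Longrightarrow> \<gamma> \<in> carrier G \<Longrightarrow> \<alpha> U = \<alpha> (\<phi> \<gamma> ` U)"
    and "\<And>U. U \<subseteq> V \<Longrightarrow> infinite U \<Longrightarrow> \<alpha> U = 0"
    and "\<And>v. v \<in> V \<Longrightarrow> finite {U. U \<subseteq> V \<and> v \<in> U \<and> \<alpha> U \<noteq> 0}"
    and "iid_process M V Z"
    and "finite S"
    and "is_factor G V \<phi> S M Z X"
    and "\<And>u. u \<in> V \<Longrightarrow> finite (W u) \<and> W u \<subseteq> V"
    and "influence_within V S M Z X W"
    and "\<exists>u\<in>V. W u \<noteq> {}"
  shows "orbit_expectation \<mu>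
           (\<lambda>o'. \<Sum>U | U \<subseteq> V \<and> o' \<in> U \<and> \<alpha> U \<noteq> 0.
              \<alpha> U / real (card U) * shannon_entropy M (joint_label X U))
         \<ge> expansion_constant V \<alpha> W * orbit_expectation \<mu> (\<lambda>o'. shannon_entropy M (X o'))"
proof -
  note \<alpha>_nonneg = assms(6) and \<alpha>_infinite = assms(8) and local_finite = assms(9)
    and W = assms(13)
  have \<alpha>_invariant: "\<alpha> (\<phi> \<gamma> ` U) = \<alpha> U" if "\<gamma> \<in> carrier G" "U \<subseteq> V" for \<gamma> U
    using assms(7)[OF that(2,1)] by simp
  interpret group_action G V \<phi> by fact
  have grp: "group G" using group_hom group_hom.axioms(1) by blast
  obtain F where F: "F \<in> PiM V (\<lambda>_. unit_lborel) \<rightarrow>\<^sub>M PiM V (\<lambda>_. count_space S)"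
    and F_eq: "\<And>\<gamma> z. \<lbrakk>\<gamma> \<in> carrier G; z \<in> space (PiM V (\<lambda>_. unit_lborel))\<rbrakk>
      \<Longrightarrow> F (act_labelling G V \<phi> \<gamma> z) = act_labelling G V \<phi> \<gamma> (F z)"
    and X_eq: "\<And>\<omega> v. \<lbrakk>\<omega> \<in> space M; v \<in> V\<rbrakk> \<Longrightarrow> X v \<omega> = F (\<lambda>u\<in>V. Z u \<omega>) v"
    using assms(12) unfolding is_factor_def by blast
  interpret prob_space M using assms(10) by (simp add: iid_process_def)
  interpret iid_factor M V Z S F
    using assms F by unfold_locales auto
  \<comment> \<open>The labels \<open>X\<close> agree with the readings of \<open>F\<close> on all outcomes, so the entropies are the same.\<close>
  have X_obs: "observed (Inl v) \<omega> = Inl (X v \<omega>)" if "\<omega> \<in> space M" "v \<in> V" for \<omega> v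
    using that by (simp add: observed_def reading_def sample_def X_eq)
  have simple_X: "simple_function M (X v)" if v: "v \<in> V" for v
  proof -
    have "simple_function M (projl \<circ> observed (Inl v))"
      using v by (intro simple_function_compose simple_label) auto
    then show ?thesis by (rule simple_function_cong[THEN iffD1, rotated]) (simp add: X_obs v)
  qed
  interpret X: label_family M X V by unfold_locales (rule simple_X)
  have H_set: "shannon_entropy M (joint_label X U) = joint_entropy (Inl ` U)" if U: "finite U" "U \<subseteq> V" for U
    unfolding joint_entropy_def using U
    by (intro antisym entropy_mono_determined simple_joint_label X.simple_joint_label)
       (auto simp: joint_label_eq_iff X.joint_label_eq_iff X_obs subset_iff)
  have H_vertex: "shannon_entropy M (X v) = joint_entropy {Inl v}" if v: "v \<in> V" for v
    using H_set[of "{v}"] X.joint_entropy_singleton[OF v] v by (simp add: X.joint_entropy_def)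
  have H_nonneg: "0 \<le> joint_entropy (Inl ` U)" if "finite U" "U \<subseteq> V" for U
    using that by (intro joint_entropy_nonneg) auto

  have bij: "bij_betw (\<phi> \<gamma>) V V" if "\<gamma> \<in> carrier G" for \<gamma>
    using that inj_prop surj_prop by (simp add: bij_betw_def)
  have equivariant: "F (\<lambda>u\<in>V. z (\<phi> \<gamma> u)) v = F z (\<phi> \<gamma> v)"
    if "\<gamma> \<in> carrier G" "z \<in> space cube" "v \<in> V" for \<gamma> z v
  proof -
    have "inv\<^bsub>G\<^esub> (inv\<^bsub>G\<^esub> \<gamma>) = \<gamma>" "inv\<^bsub>G\<^esub> \<gamma> \<in> carrier G"
      using grp that(1) by (auto simp: group.inv_inv)
    with F_eq[of "inv\<^bsub>G\<^esub> \<gamma>" z] that show ?thesis by (simp add: act_labelling_def)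
  qed
  have inverse: "\<phi> (inv\<^bsub>G\<^esub> \<gamma>) (\<phi> \<gamma> v) = v" "\<phi> \<gamma> v \<in> V" if "\<gamma> \<in> carrier G" "v \<in> V" for \<gamma> v
    using that orbit_sym_aux element_image by auto
  have inv_closed: "inv\<^bsub>G\<^esub> \<gamma> \<in> carrier G" if "\<gamma> \<in> carrier G" for \<gamma>
    using grp that by simp
  have image_inverse: "\<phi> (inv\<^bsub>G\<^esub> \<gamma>) ` \<phi> \<gamma> ` U = U" "\<phi> \<gamma> ` U \<subseteq> V" if "\<gamma> \<in> carrier G" "U \<subseteq> V" for \<gamma> U
    using inverse[OF that(1)] that(2) by (force simp: image_image)+
  have share_invariant: "full_share (\<phi> \<gamma> ` U) (\<phi> \<gamma> u) = full_share U u"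
    if "\<gamma> \<in> carrier G" "finite U" "U \<subseteq> V" "u \<in> V" for \<gamma> U u
  proof (rule antisym)
    show "full_share U u \<le> full_share (\<phi> \<gamma> ` U) (\<phi> \<gamma> u)"
      using that bij equivariant by (intro full_share_relabel_le) auto
    have "full_share (\<phi> \<gamma> ` U) (\<phi> \<gamma> u) \<le> full_share (\<phi> (inv\<^bsub>G\<^esub> \<gamma>) ` \<phi> \<gamma> ` U) (\<phi> (inv\<^bsub>G\<^esub> \<gamma>) (\<phi> \<gamma> u))"
      using that bij equivariant inverse image_inverse inv_closed by (intro full_share_relabel_le) auto
    then show "full_share (\<phi> \<gamma> ` U) (\<phi> \<gamma> u) \<le> full_share U u"
      using that inverse image_inverse by simp
  qed

  define \<U> where "\<U> v = {U. U \<subseteq> V \<and> v \<in> U \<and> \<alpha> U \<noteq> 0}" for v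
  have \<U>_finite: "finite (\<U> v)" if "v \<in> V" for v using local_finite[OF that] by (simp add: \<U>_def)
  have \<U>_mem: "finite U" "U \<subseteq> V" "v \<in> U" "0 \<le> \<alpha> U" "0 < card U" if "U \<in> \<U> v" for U v
  proof -
    show *: "finite U" "U \<subseteq> V" "v \<in> U" "0 \<le> \<alpha> U" using that \<alpha>_infinite \<alpha>_nonneg by (auto simp: \<U>_def)
    then show "0 < card U" by (auto simp: card_gt_0_iff)
  qed
  have \<U>_image: "\<U> (\<phi> \<gamma> v) = (`) (\<phi> \<gamma>) ` \<U> v" if "\<gamma> \<in> carrier G" "v \<in> V" for \<gamma> v
  proof
    show "(`) (\<phi> \<gamma>) ` \<U> v \<subseteq> \<U> (\<phi> \<gamma> v)"
      using that \<alpha>_invariant inverse(2) by (auto simp: \<U>_def subset_iff)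
    show "\<U> (\<phi> \<gamma> v) \<subseteq> (`) (\<phi> \<gamma>) ` \<U> v"
    proof
      fix U assume U: "U \<in> \<U> (\<phi> \<gamma> v)"
      have UV: "U \<subseteq> V" using U by (simp add: \<U>_def)
      have "\<phi> \<gamma> ` \<phi> (inv\<^bsub>G\<^esub> \<gamma>) ` U = U"
        using image_inverse(1)[OF inv_closed[OF that(1)] UV] grp that(1) by (simp add: group.inv_inv)
      moreover have "v \<in> \<phi> (inv\<^bsub>G\<^esub> \<gamma>) ` U"
        using U inverse(1)[OF that] by (auto simp: \<U>_def intro: rev_image_eqI)
      then have "\<phi> (inv\<^bsub>G\<^esub> \<gamma>) ` U \<in> \<U> v"
        using U \<alpha>_invariant[OF inv_closed[OF that(1)] UV] image_inverse(2)[OF inv_closed[OF that(1)] UV]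
        by (simp add: \<U>_def)
      ultimately show "U \<in> (`) (\<phi> \<gamma>) ` \<U> v" by (metis imageI)
    qed
  qed

  define \<beta> where "\<beta> = expansion_constant V \<alpha> W"
  define meeting where "meeting A = {U. U \<subseteq> V \<and> U \<inter> A \<noteq> {} \<and> \<alpha> U \<noteq> 0}" for A
  have meeting_finite: "finite (meeting A)" if "finite A" "A \<subseteq> V" for A
  proof -
    have "meeting A = (\<Union>v\<in>A. \<U> v)" by (auto simp: meeting_def \<U>_def)
    with that \<U>_finite show ?thesis by auto
  qed
  let ?ratios = "{(\<Sum>U\<in>meeting A. \<alpha> U) / real (card A) | u A. u \<in> V \<and> A \<subseteq> W u \<and> A \<noteq> {}}"
  have \<beta>_Inf: "\<beta> = Inf ?ratios"
    by (simp add: \<beta>_def expansion_constant_def meeting_def)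
  have ratio_nonneg: "0 \<le> r" if "r \<in> ?ratios" for r
    using that \<alpha>_nonneg by (auto simp: meeting_def intro!: divide_nonneg_nonneg sum_nonneg)
  have \<beta>_nonneg: "0 \<le> \<beta>"
    unfolding \<beta>_Inf using assms(15) ratio_nonneg by (intro cInf_greatest) blast+
  have \<beta>_le: "\<beta> * real (card A) \<le> (\<Sum>U\<in>meeting A. \<alpha> U)" if "u \<in> V" "A \<subseteq> W u" "A \<noteq> {}" for u A
  proof -
    have "\<beta> \<le> (\<Sum>U\<in>meeting A. \<alpha> U) / real (card A)"
      unfolding \<beta>_Inf using that ratio_nonneg by (intro cInf_lower bdd_belowI[of _ 0]) blast+
    moreover have "0 < card A" using that W[of u] finite_subset by (auto simp: card_gt_0_iff)
    ultimately show ?thesis by (simp add: field_simps)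
  qed

  define f where "f v u = (\<Sum>U\<in>\<U> v. ennreal (\<alpha> U / real (card U)) * full_share U u)" for v u
  define g where "g v u = full_share {v} u" for v u
  have f_invariant: "diagonally_invariant G V \<phi> f"
    unfolding diagonally_invariant_def
  proof (intro ballI)
    fix \<gamma> v u assume a: "\<gamma> \<in> carrier G" "v \<in> V" "u \<in> V"
    have inj: "inj_on ((`) (\<phi> \<gamma>)) (\<U> v)"
      using image_inverse(1)[OF a(1)] by (intro inj_on_inverseI[of _ "(`) (\<phi> (inv\<^bsub>G\<^esub> \<gamma>))"]) (auto simp: \<U>_def)
    show "f (\<phi> \<gamma> v) (\<phi> \<gamma> u) = f v u"
      unfolding f_def \<U>_image[OF a(1,2)] sum.reindex[OF inj] comp_def
    proof (rule sum.cong[OF refl])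
      fix U assume U: "U \<in> \<U> v"
      have "card (\<phi> \<gamma> ` U) = card U"
        using \<U>_mem[OF U] inj_prop[OF a(1)] by (intro card_image) (auto intro: inj_on_subset)
      then show "ennreal (\<alpha> (\<phi> \<gamma> ` U) / real (card (\<phi> \<gamma> ` U))) * full_share (\<phi> \<gamma> ` U) (\<phi> \<gamma> u)
          = ennreal (\<alpha> U / real (card U)) * full_share U u"
        using \<U>_mem[OF U] a share_invariant \<alpha>_invariant[of \<gamma> U] by simp
    qed
  qed
  have g_invariant: "diagonally_invariant G V \<phi> g"
    unfolding diagonally_invariant_def g_def
    using share_invariant[of _ "{v}" for v] by auto

  have g_zero: "g v u = 0" if uv: "u \<in> V" "v \<in> V" "v \<notin> W u" for u v
  proof -
    obtain h where h: "h \<in> PiM {u\<in>V. v \<in> W u} (\<lambda>_. unit_lborel) \<rightarrow>\<^sub>M count_space S"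
      "AE \<omega> in M. X v \<omega> = h (\<lambda>u\<in>{u\<in>V. v \<in> W u}. Z u \<omega>)"
      using assms(14) uv(2) unfolding influence_within_def by blast
    have "AE \<omega> in M. F (sample \<omega>) v = h (\<lambda>u\<in>{u\<in>V. v \<in> W u}. Z u \<omega>)"
      using h(2) AE_space by eventually_elim (simp add: X_eq uv(2) sample_def)
    then show ?thesis
      unfolding g_def using uv h(1) by (intro full_share_zero[of v u "{u\<in>V. v \<in> W u}"]) auto
  qed

  let ?lhs = "\<lambda>o'. \<Sum>U\<in>\<U> o'. \<alpha> U / real (card U) * shannon_entropy M (joint_label X U)"
  \<comment> \<open>The mass sent out by \<open>v\<close> is bounded through \<open>\<Sum>\<^sub>u J(U, u) \<le> H(X\<^sub>U)\<close>.\<close>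
  have f_out: "(\<integral>\<^sup>+u. f v u \<partial>count_space V) \<le> ennreal (?lhs v)" if v: "v \<in> V" for v
  proof -
    have "(\<integral>\<^sup>+u. f v u \<partial>count_space V)
        = (\<Sum>U\<in>\<U> v. ennreal (\<alpha> U / real (card U)) * (\<integral>\<^sup>+u. full_share U u \<partial>count_space V))"
      unfolding f_def by (simp add: nn_integral_sum nn_integral_cmult)
    also have "\<dots> \<le> (\<Sum>U\<in>\<U> v. ennreal (\<alpha> U / real (card U)) * ennreal (joint_entropy (Inl ` U)))"
      using \<U>_mem by (intro sum_mono mult_left_mono sum_full_share_le) auto
    also have "\<dots> = (\<Sum>U\<in>\<U> v. ennreal (\<alpha> U / real (card U) * shannon_entropy M (joint_label X U)))"
    proof (rule sum.cong[OF refl])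
      fix U assume U: "U \<in> \<U> v"
      show "ennreal (\<alpha> U / real (card U)) * ennreal (joint_entropy (Inl ` U))
          = ennreal (\<alpha> U / real (card U) * shannon_entropy M (joint_label X U))"
        using \<U>_mem[OF U] H_nonneg[of U] by (simp add: H_set flip: ennreal_mult)
    qed
    also have "\<dots> = ennreal (?lhs v)"
      using \<U>_mem H_nonneg by (intro sum_ennreal) (simp add: H_set)
    finally show ?thesis .
  qed
  \<comment> \<open>The mass received by \<open>u\<close> comes from every element of each \<open>U\<close>, which cancels the factor \<open>1 / |U|\<close>.
    Only sets that meet \<open>W u\<close> are kept, which makes the sum over \<open>U\<close> finite.\<close>
  have f_in: "ennreal \<beta> * (\<integral>\<^sup>+v. g v u \<partial>count_space V) \<le> (\<integral>\<^sup>+v. f v u \<partial>count_space V)" if u: "u \<in> V" for u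
  proof -
    note Wu = conjunct1[OF W[OF u]] conjunct2[OF W[OF u]]
    have m: "finite U" "U \<subseteq> V" "0 \<le> \<alpha> U" "0 < card U" if U: "U \<in> meeting (W u)" for U
    proof -
      obtain v where "U \<in> \<U> v" using U by (auto simp: meeting_def \<U>_def)
      then show "finite U" "U \<subseteq> V" "0 \<le> \<alpha> U" "0 < card U" using \<U>_mem by auto
    qed
    have "(\<integral>\<^sup>+v. g v u \<partial>count_space V) = (\<Sum>v\<in>W u. full_share {v} u)"
      using Wu g_zero[OF u] by (subst nn_integral_count_space'[of "W u"]) (auto simp: g_def)
    then have "ennreal \<beta> * (\<integral>\<^sup>+v. g v u \<partial>count_space V) \<le> (\<Sum>U\<in>meeting (W u). ennreal (\<alpha> U) * full_share U u)"
    proof (simp only:, intro full_share_domination Wu meeting_finite \<beta>_nonneg)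
      fix A assume A: "A \<subseteq> W u" "A \<noteq> {}"
      have "{U \<in> meeting (W u). U \<inter> A \<noteq> {}} = meeting A" using A by (auto simp: meeting_def)
      with \<beta>_le[OF u A] show "\<beta> * real (card A) \<le> (\<Sum>U | U \<in> meeting (W u) \<and> U \<inter> A \<noteq> {}. \<alpha> U)" by simp
    qed (use m in auto)
    also have "\<dots> = (\<Sum>U\<in>meeting (W u). \<integral>\<^sup>+v. (if v \<in> U then ennreal (\<alpha> U / real (card U)) * full_share U u else 0) \<partial>count_space V)"
    proof (rule sum.cong[OF refl])
      fix U assume U: "U \<in> meeting (W u)"
      have "(\<integral>\<^sup>+v. (if v \<in> U then ennreal (\<alpha> U / real (card U)) * full_share U u else 0) \<partial>count_space V)
          = of_nat (card U) * (ennreal (\<alpha> U / real (card U)) * full_share U u)"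
        using m[OF U] by (subst nn_integral_count_space'[of U]) auto
      also have "\<dots> = ennreal (real (card U) * (\<alpha> U / real (card U))) * full_share U u"
        using m[OF U] by (subst ennreal_mult) (auto simp: ennreal_of_nat_eq_real_of_nat mult_ac)
      finally show "ennreal (\<alpha> U) * full_share U u
          = (\<integral>\<^sup>+v. (if v \<in> U then ennreal (\<alpha> U / real (card U)) * full_share U u else 0) \<partial>count_space V)"
        using m[OF U] by (auto simp: card_gt_0_iff)
    qed
    also have "\<dots> = (\<integral>\<^sup>+v. (\<Sum>U\<in>meeting (W u). if v \<in> U then ennreal (\<alpha> U / real (card U)) * full_share U u else 0) \<partial>count_space V)"
      by (rule nn_integral_sum[symmetric]) simp
    also have "\<dots> \<le> (\<integral>\<^sup>+v. f v u \<partial>count_space V)"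
    proof (rule nn_integral_mono)
      fix v assume "v \<in> space (count_space V)"
      then have v: "v \<in> V" by simp
      have "(\<Sum>U\<in>meeting (W u). if v \<in> U then ennreal (\<alpha> U / real (card U)) * full_share U u else 0)
          = (\<Sum>U\<in>{U\<in>meeting (W u). v \<in> U}. ennreal (\<alpha> U / real (card U)) * full_share U u)"
        using meeting_finite[OF Wu] by (simp add: sum.inter_filter)
      also have "\<dots> \<le> f v u"
        unfolding f_def using \<U>_finite[OF v] by (intro sum_mono2) (auto simp: meeting_def \<U>_def)
      finally show "(\<Sum>U\<in>meeting (W u). if v \<in> U then ennreal (\<alpha> U / real (card U)) * full_share U u else 0) \<le> f v u" .
    qed
    finally show ?thesis .
  qed

  note rep = orbit_representative[OF assms(2,4)]
  have mtp: "orbit_nn_expectation \<mu> (\<lambda>o'. \<integral>\<^sup>+v. h o' v \<partial>count_space V) = orbit_nn_expectation \<mu> (\<lambda>o'. \<integral>\<^sup>+v. h v o' \<partial>count_space V)"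
    if "diagonally_invariant G V \<phi> h" for h
    using assms(5) that by (simp add: mass_transport_principle_def)
  \<comment> \<open>The entropies are collected as mass leaving \<open>v\<close>, seen as mass of \<open>g\<close> arriving at \<open>u\<close>, compared
    there with \<open>f\<close>, and the mass of \<open>f\<close> is traced back to where it was sent.\<close>
  have "ennreal (\<beta> * orbit_expectation \<mu> (\<lambda>o'. shannon_entropy M (X o')))
      = ennreal \<beta> * orbit_nn_expectation \<mu> (\<lambda>o'. ennreal (shannon_entropy M (X o')))"
    using rep H_vertex H_nonneg[of "{v}" for v] \<beta>_nonneg
    by (subst orbit_nn_expectation_ennreal) (auto simp: ennreal_mult')
  also have "\<dots> \<le> ennreal \<beta> * orbit_nn_expectation \<mu> (\<lambda>o'. \<integral>\<^sup>+u. g o' u \<partial>count_space V)"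
    using rep H_vertex sum_full_share_singleton_ge
    by (intro mult_left_mono orbit_nn_expectation_mono) (auto simp: g_def)
  also have "\<dots> = orbit_nn_expectation \<mu> (\<lambda>o'. ennreal \<beta> * (\<integral>\<^sup>+v. g v o' \<partial>count_space V))"
    by (simp add: mtp[OF g_invariant] orbit_nn_expectation_cmult)
  also have "\<dots> \<le> orbit_nn_expectation \<mu> (\<lambda>o'. \<integral>\<^sup>+v. f v o' \<partial>count_space V)"
    using rep f_in by (intro orbit_nn_expectation_mono) auto
  also have "\<dots> = orbit_nn_expectation \<mu> (\<lambda>o'. \<integral>\<^sup>+u. f o' u \<partial>count_space V)"
    by (rule mtp[OF f_invariant, symmetric])
  also have "\<dots> \<le> orbit_nn_expectation \<mu> (\<lambda>o'. ennreal (?lhs o'))"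
    using rep f_out by (intro orbit_nn_expectation_mono) auto
  finally have main: "ennreal (\<beta> * orbit_expectation \<mu> (\<lambda>o'. shannon_entropy M (X o')))
      \<le> orbit_nn_expectation \<mu> (\<lambda>o'. ennreal (?lhs o'))" .
  have lhs_nonneg: "0 \<le> ?lhs o'" for o'
    using \<U>_mem H_nonneg by (auto simp: H_set intro!: sum_nonneg)
  then have "orbit_nn_expectation \<mu> (\<lambda>o'. ennreal (?lhs o')) = ennreal (orbit_expectation \<mu> ?lhs)"
    by (intro orbit_nn_expectation_ennreal)
  moreover have "0 \<le> orbit_expectation \<mu> ?lhs"
    unfolding orbit_expectation_def by (intro sum_nonneg mult_nonneg_nonneg[OF pmf_nonneg lhs_nonneg])
  ultimately have "\<beta> * orbit_expectation \<mu> (\<lambda>o'. shannon_entropy M (X o')) \<le> orbit_expectation \<mu> ?lhs"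
    using main by (simp add: ennreal_le_iff)
  then show ?thesis by (simp add: \<beta>_def \<U>_def)
qed

end
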